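(* Let $k$ be a field and let $d\ge 2$, $m\ge 2$ be integers. Let $j$ be an integer with $j\ge\binom{d+m-1}{m-1}$ (for $m=2$ this reads $j\ge d+1$), and let $\mathbf{b}\in\mathbb{N}\mathcal{A}$ with $|\mathbf{b}|=dj$. If $\mathbf{b}_0\le\tilde{l}_j$, then $\beta_{p,\mathbf{b}}=0$ for all $p\in\mathbb{Z}$.
   Context: $\mathbb{N}$ includes $0$; coordinates of vectors in $\mathbb{Z}^{m+1}$ are indexed $0,1,\dots,m$, and $|\mathbf{a}|=\mathbf{a}_0+\dots+\mathbf{a}_m$. Let $\mathcal{A}=\{\mathbf{a}\in\mathbb{N}^{m+1}: |\mathbf{a}|=d\}$, which has $n=\binom{d+m}{m}$ elements. They are listed as $\mathbf{a}^1,\dots,\mathbf{a}^n$ in lexicographic order with the lexicographically largest first, so $\mathbf{a}^1=(d,0,\dots,0)$, ..., $\mathbf{a}^n=(0,\dots,0,d)$. $\mathbb{N}\mathcal{A}\subset\mathbb{N}^{m+1}$ is the semigroup (with $\mathbf{0}$) generated by $\mathcal{A}$. Let $S=k[x_1,\dots,x_n]$ with the $\mathbb{Z}^{m+1}$-grading $\deg(x_i)=\mathbf{a}^i$. The semigroup ring $k[\mathbb{N}\mathcal{A}]$ (the $d$-th Veronese subring of $k[y_0,\dots,y_m]$) is a $\mathbb{Z}^{m+1}$-graded $S$-module via $x_i\mapsto \mathbf{y}^{\mathbf{a}^i}$. The multigraded Betti number is $\beta_{p,\mathbf{b}}=\dim_k \mathrm{Tor}^S_p(k[\mathbb{N}\mathcal{A}],k)_{\mathbf{b}}$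 (zero for $p<0$). Definition of $\tilde l_j$: put $A_j=\sum_{i=1}^{\min(j,n)}\mathbf{a}^i_0$ and $A=\sum_{i=1}^n\mathbf{a}^i_0$. For $0\le l\le A$ let $C_l=\{\sigma\subset\{1,\dots,n\}: \sum_{i\in\sigma}\mathbf{a}^i_0=l\}$ (a nonempty set) and $f_l=\max_{\sigma\in C_l}\sum_{i\in\sigma}\mathbf{a}^i_1$. For $j\ge\binom{d+m-1}{m-1}$ let $\phi(l)=\lceil\frac{dj-l}{m}\rceil-f_l$ for $l\in\{0,\dots,A_j-1\}$ (this is a non-increasing function), and let $\tilde l_j$ be the largest $l\in\{0,\dots,A_j-1\}$ with $\phi(l)\ge 0$. *)

theory Defs
  imports Complex_Main "HOL-Library.Poly_Mapping" "HOL-Library.Extended_Nat"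
begin

text \<open>Vectors of \<open>\<int>\<^bsup>m+1\<^esup>\<close> are the elements of \<open>zvecs m\<close>. The library's linear order
  on \<^typ>\<open>nat \<Rightarrow>\<^sub>0 int\<close> is lexicographic, coordinate 0 being the most significant one.\<close>

type_synonym vec = "nat \<Rightarrow>\<^sub>0 int"

abbreviation keys :: "('a \<Rightarrow>\<^sub>0 'b::zero) \<Rightarrow> 'a set" where
  "keys \<equiv> Poly_Mapping.keys"

abbreviation lookup :: "('a \<Rightarrow>\<^sub>0 'b::zero) \<Rightarrow> 'a \<Rightarrow> 'b" where
  "lookup \<equiv> Poly_Mapping.lookup"

definition zvecs :: "nat \<Rightarrow> vec set" where
  "zvecs m = {v. keys v \<subseteq> {..m}}"

definition total :: "nat \<Rightarrow> vec \<Rightarrow> int" where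
  "total m v = (\<Sum>r\<le>m. lookup v r)"

definition Avecs :: "nat \<Rightarrow> nat \<Rightarrow> vec set" where
  "Avecs d m = {a \<in> zvecs m. (\<forall>r. 0 \<le> lookup a r) \<and> total m a = int d}"

definition nvars :: "nat \<Rightarrow> nat \<Rightarrow> nat" where
  "nvars d m = card (Avecs d m)"

text \<open>\<open>avec d m i\<close> is \<open>a\<^sup>i\<close>; it is meaningful for \<open>1 \<le> i \<le> nvars d m\<close>.\<close>

definition avec :: "nat \<Rightarrow> nat \<Rightarrow> nat \<Rightarrow> vec" where
  "avec d m i = rev (sorted_list_of_set (Avecs d m)) ! (i - 1)"

inductive_set NA :: "nat \<Rightarrow> nat \<Rightarrow> vec set" for d m where
  zero: "0 \<in> NA d m"
| add: "a \<in> Avecs d m \<Longrightarrow> v \<in> NA d m \<Longrightarrow> a + v \<in> NA d m"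


section \<open>The threshold\<close>

definition Asum :: "nat \<Rightarrow> nat \<Rightarrow> nat \<Rightarrow> int" where
  "Asum d m j = (\<Sum>i = 1..min j (nvars d m). lookup (avec d m i) 0)"

definition Cset :: "nat \<Rightarrow> nat \<Rightarrow> int \<Rightarrow> nat set set" where
  "Cset d m l = {\<sigma>. \<sigma> \<subseteq> {1..nvars d m} \<and> (\<Sum>i\<in>\<sigma>. lookup (avec d m i) 0) = l}"

definition fmax :: "nat \<Rightarrow> nat \<Rightarrow> int \<Rightarrow> int" where
  "fmax d m l = Max ((\<lambda>\<sigma>. \<Sum>i\<in>\<sigma>. lookup (avec d m i) 1) ` Cset d m l)"

definition phi :: "nat \<Rightarrow> nat \<Rightarrow> nat \<Rightarrow> int \<Rightarrow> int" where
  "phi d m j l = \<lceil>(real d * real j - real_of_int l) / real m\<rceil> - fmax d m l"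

definition ltilde :: "nat \<Rightarrow> nat \<Rightarrow> nat \<Rightarrow> int" where
  "ltilde d m j = Max {l \<in> {0..Asum d m j - 1}. phi d m j l \<ge> 0}"


section \<open>Graded modules over the polynomial ring\<close>

text \<open>\<open>S\<close> is the set \<open>polyS d m\<close> of polynomials in the variables \<open>x\<^sub>i\<close>, \<open>1 \<le> i \<le> n\<close>; a key
  \<open>u\<close> stands for the monomial with exponents \<open>lookup u i\<close>.\<close>

type_synonym 'k pol = "(nat \<Rightarrow>\<^sub>0 nat) \<Rightarrow>\<^sub>0 'k"

definition polyS :: "nat \<Rightarrow> nat \<Rightarrow> 'k::field pol set" where
  "polyS d m = {f. \<forall>u\<in>keys f. keys u \<subseteq> {1..nvars d m}}"

definition monom_deg :: "nat \<Rightarrow> nat \<Rightarrow> (nat \<Rightarrow>\<^sub>0 nat) \<Rightarrow> vec" where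
  "monom_deg d m u = (\<Sum>i\<in>keys u. Poly_Mapping.map (\<lambda>z. int (lookup u i) * z) (avec d m i))"

record (overloaded) ('k::zero, 'a) graded_module =
  carr :: "'a set"
  comp :: "vec \<Rightarrow> 'a set"  \<comment> \<open>homogeneous components\<close>
  act :: "'k pol \<Rightarrow> 'a \<Rightarrow> 'a"

definition S_mod :: "nat \<Rightarrow> nat \<Rightarrow> ('k::field, 'k pol) graded_module" where
  "S_mod d m = \<lparr>carr = polyS d m,
     comp = (\<lambda>b. {f \<in> polyS d m. \<forall>u\<in>keys f. monom_deg d m u = b}),
     act = (*)\<rparr>"

text \<open>The residue field \<open>S / (x\<^sub>1, \<dots>, x\<^sub>n)\<close>, in degree 0.\<close>

definition k_mod :: "('k::field, 'k) graded_module" where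
  "k_mod = \<lparr>carr = UNIV, comp = (\<lambda>b. if b = 0 then UNIV else {0}),
     act = (\<lambda>f c. lookup f 0 * c)\<rparr>"

text \<open>The semigroup ring sits inside the group ring of the exponent vectors, whose product is
  the convolution product of \<^typ>\<open>vec \<Rightarrow>\<^sub>0 'k\<close>; \<open>veronese_hom\<close> is the homomorphism
  sending \<open>x\<^sub>i\<close> to \<open>y\<close> to the power \<open>a\<^sup>i\<close>.\<close>

definition veronese_hom :: "nat \<Rightarrow> nat \<Rightarrow> 'k::field pol \<Rightarrow> (vec \<Rightarrow>\<^sub>0 'k)" where
  "veronese_hom d m f = (\<Sum>u\<in>keys f. Poly_Mapping.single (monom_deg d m u) (lookup f u))"

definition NA_mod :: "nat \<Rightarrow> nat \<Rightarrow> ('k::field, vec \<Rightarrow>\<^sub>0 'k) graded_module" where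
  "NA_mod d m = \<lparr>carr = {g. keys g \<subseteq> NA d m},
     comp = (\<lambda>b. {g. keys g \<subseteq> NA d m \<inter> {b}}),
     act = (\<lambda>f g. veronese_hom d m f * g)\<rparr>"


section \<open>Graded free resolutions and Tor\<close>

text \<open>A complex \<open>F\<close> of graded free modules augmented to a module: \<open>F\<^sub>p\<close> is free on the
  generators \<open>gens F p\<close>, the generator \<open>g\<close> having degree \<open>gdeg F p g\<close>; for \<open>p \<ge> 1\<close> its image
  in \<open>F\<^bsub>p-1\<^esub>\<close> is \<open>diff F p g\<close>, written as a combination of the generators of
  \<open>F\<^bsub>p-1\<^esub>\<close> (\<open>diff F 0\<close> is not used), and for \<open>p = 0\<close> its image in the module is \<open>aug F g\<close>.
  Numbering generators by naturals restricts to countable rank, which is enough for modules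
  of countable dimension over \<open>k\<close>.\<close>

record (overloaded) ('k::zero, 'a) free_complex =
  gens :: "nat \<Rightarrow> nat set"
  gdeg :: "nat \<Rightarrow> nat \<Rightarrow> vec"
  diff :: "nat \<Rightarrow> nat \<Rightarrow> (nat \<Rightarrow>\<^sub>0 'k pol)"
  aug :: "nat \<Rightarrow> 'a"

text \<open>\<open>Y \<otimes> F\<^sub>p\<close> is a direct sum of copies of \<open>Y\<close>, one for each generator, shifted by its degree:
  the element \<open>w\<close> stands for the sum of all \<open>lookup w g \<otimes> g\<close>. In particular \<open>F\<close> itself is
  the case \<open>Y = S\<close>.\<close>

definition chains ::
    "('k::field, 'y::ab_group_add) graded_module \<Rightarrow> ('k, 'a) free_complex \<Rightarrow> nat \<Rightarrow> (nat \<Rightarrow>\<^sub>0 'y) set" where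
  "chains Y F p = {w. keys w \<subseteq> gens F p \<and> (\<forall>g\<in>gens F p. lookup w g \<in> carr Y)}"

definition chains_deg ::
    "('k::field, 'y::ab_group_add) graded_module \<Rightarrow> ('k, 'a) free_complex \<Rightarrow> nat \<Rightarrow> vec \<Rightarrow> (nat \<Rightarrow>\<^sub>0 'y) set" where
  "chains_deg Y F p b =
     {w. keys w \<subseteq> gens F p \<and> (\<forall>g\<in>gens F p. lookup w g \<in> comp Y (b - gdeg F p g))}"

definition bd ::
    "('k::field, 'y::ab_group_add) graded_module \<Rightarrow> ('k, 'a) free_complex \<Rightarrow> nat \<Rightarrow> (nat \<Rightarrow>\<^sub>0 'y) \<Rightarrow> (nat \<Rightarrow>\<^sub>0 'y)" where
  "bd Y F p w = (if p = 0 then 0 else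
     (\<Sum>g\<in>keys w. \<Sum>h\<in>keys (diff F p g).
        Poly_Mapping.single h (act Y (lookup (diff F p g) h) (lookup w g))))"

definition aug_map ::
    "('k::field, 'a::ab_group_add) graded_module \<Rightarrow> ('k, 'a) free_complex \<Rightarrow> (nat \<Rightarrow>\<^sub>0 'k pol) \<Rightarrow> 'a" where
  "aug_map N F w = (\<Sum>g\<in>keys w. act N (lookup w g) (aug F g))"

definition graded_free_resolution ::
    "nat \<Rightarrow> nat \<Rightarrow> ('k::field, 'a::ab_group_add) graded_module \<Rightarrow> ('k, 'a) free_complex \<Rightarrow> bool" where
  "graded_free_resolution d m N F \<longleftrightarrow>
     (\<forall>p. \<forall>g\<in>gens F p. gdeg F p g \<in> zvecs m) \<and>
     (\<forall>p. \<forall>g\<in>gens F (Suc p).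
        diff F (Suc p) g \<in> chains_deg (S_mod d m) F p (gdeg F (Suc p) g)) \<and>
     (\<forall>g\<in>gens F 0. aug F g \<in> comp N (gdeg F 0 g)) \<and>
     aug_map N F ` chains (S_mod d m) F 0 = carr N \<and>
     {w \<in> chains (S_mod d m) F 0. aug_map N F w = 0} =
        bd (S_mod d m) F 1 ` chains (S_mod d m) F 1 \<and>
     (\<forall>p\<ge>1. {w \<in> chains (S_mod d m) F p. bd (S_mod d m) F p w = 0} =
        bd (S_mod d m) F (p + 1) ` chains (S_mod d m) F (p + 1))"

text \<open>The dimension of the quotient of \<open>Z\<close> by its subspace \<open>B\<close>: the set \<open>X\<close> below represents a
  basis of the quotient.\<close>

definition quotient_basis ::
    "('k::field \<Rightarrow> 'v::ab_group_add \<Rightarrow> 'v) \<Rightarrow> 'v set \<Rightarrow> 'v set \<Rightarrow> 'v set \<Rightarrow> bool" where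
  "quotient_basis scale Z B X \<longleftrightarrow>
     X \<subseteq> Z \<and> \<not> module.dependent scale X \<and> module.span scale X \<inter> B = {0} \<and>
     Z = {x + y | x y. x \<in> module.span scale X \<and> y \<in> B}"

definition quotient_dim ::
    "('k::field \<Rightarrow> 'v::ab_group_add \<Rightarrow> 'v) \<Rightarrow> 'v set \<Rightarrow> 'v set \<Rightarrow> enat" where
  "quotient_dim scale Z B =
     (if \<exists>X. finite X \<and> quotient_basis scale Z B X
      then enat (card (SOME X. finite X \<and> quotient_basis scale Z B X)) else \<infinity>)"

definition chain_scale ::
    "('k::field, 'y::ab_group_add) graded_module \<Rightarrow> 'k \<Rightarrow> (nat \<Rightarrow>\<^sub>0 'y) \<Rightarrow> (nat \<Rightarrow>\<^sub>0 'y)" where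
  "chain_scale Y c w = Poly_Mapping.map (act Y (Poly_Mapping.single 0 c)) w"

text \<open>The dimension of \<open>Tor\<^sub>p(M, N)\<close> in degree \<open>b\<close>, with \<open>Tor(M, -)\<close> computed as the homology of
  \<open>M \<otimes> F\<close> for a graded free resolution \<open>F\<close> of \<open>N\<close>; it does not depend on the choice of \<open>F\<close>.\<close>

definition tor_dim ::
    "nat \<Rightarrow> nat \<Rightarrow> ('k::field, 'y::ab_group_add) graded_module \<Rightarrow> ('k, 'a::ab_group_add) graded_module
      \<Rightarrow> nat \<Rightarrow> vec \<Rightarrow> enat" where
  "tor_dim d m M N p b =
     (let F = (SOME F. graded_free_resolution d m N F) in
      quotient_dim (chain_scale M)
        {w \<in> chains_deg M F p b. bd M F p w = 0}
        (bd M F (p + 1) ` chains_deg M F (p + 1) b))"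

text \<open>The itself argument fixes the field.\<close>

definition betti :: "'k::field itself \<Rightarrow> nat \<Rightarrow> nat \<Rightarrow> int \<Rightarrow> vec \<Rightarrow> enat" where
  "betti K d m p b = (if p < 0 then 0 else
     tor_dim d m (NA_mod d m :: ('k, vec \<Rightarrow>\<^sub>0 'k) graded_module) (k_mod :: ('k, 'k) graded_module) (nat p) b)"

end

theory Submission
  imports Defs "HOL-Library.Nat_Bijection"
begin

text \<open>Two graded free resolutions of \<open>k\<close> are homotopy equivalent, so \<open>Tor\<close> vanishes in degree \<open>b\<close>
  as soon as the degree-\<open>b\<close> strand of the Koszul complex with coefficients in \<open>k[NA]\<close> is exact.
  Since \<open>b\<^sub>0 \<le> l\<close> for the threshold \<open>l\<close>, some coordinate \<open>b\<^sub>s\<close> with \<open>s \<ge> 1\<close> is at least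
  \<open>\<lceil>(dj - l) / m\<rceil> \<ge> f\<^sub>l\<close>. By the symmetry in the coordinates \<open>1, \<dots>, m\<close> and the monotonicity of \<open>f\<close>,
  every \<open>\<sigma>\<close> whose vectors have coordinates 0 summing up to at most \<open>b\<^sub>0\<close> has coordinates \<open>s\<close> summing
  up to at most \<open>b\<^sub>s\<close>. Adding \<open>d \<cdot> e\<^sub>s\<close> to \<open>\<sigma>\<close> therefore never violates the condition
  \<open>b - (\<Sum>i\<in>\<sigma>. a\<^sup>i) \<in> NA\<close>: the strand is the chain complex of a cone, which is contractible.\<close>

section \<open>Linear maps between free modules\<close>

text \<open>\<open>tor_dim\<close> refers to a resolution selected by \<open>SOME\<close>, of which
  nothing is known beyond its being a graded free resolution. Hence the Koszul complex has to be
  proved a resolution, and exactness in degree \<open>b\<close> has to be moved from it to the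
  selected \<open>F\<close>; for this, maps \<open>F \<rightarrow> G \<rightarrow> F\<close> whose
  composite is homotopic to the identity suffice. All these maps have matrices over
  \<open>S\<close>, so identities proved over \<open>S\<close> carry over to every coefficient
  module. One contraction serves both for the exactness of the Koszul complex and for the cone. It
  needs only an additive left inverse \<open>D\<close> of the action of one variable that commutes
  with the other variables. On \<open>S\<close> this is division by the variable, killing the
  monomials free of it. On k[NA] it is multiplication by y to the power -a^v, which makes sense in
  the group ring; the cone condition brings the result back into the semigroup ring. The bound on
  \<open>j\<close> guarantees that 0 is a candidate in the maximum defining \<open>ltilde\<close>:
  by symmetry, \<open>m\<close> times the value of \<open>f\<close> at 0 is at most \<open>d\<close>
  times the number of vectors with coordinate 0 equal to 0.\<close>

abbreviation single :: "'a \<Rightarrow> 'b::zero \<Rightarrow> 'a \<Rightarrow>\<^sub>0 'b" where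
  "single \<equiv> Poly_Mapping.single"

text \<open>This is the map \<open>Y \<otimes> F \<rightarrow> Y \<otimes> G\<close> induced by the
  matrix \<open>t\<close> with entries in \<open>S\<close>, where \<open>sc\<close> is the action on
  \<open>Y\<close>. Differentials, chain maps and homotopies are all of this form, so each is given
  by its values on generators.\<close>

definition lin_ext ::
    "('k::field pol \<Rightarrow> 'y \<Rightarrow> 'y::ab_group_add) \<Rightarrow> (nat \<Rightarrow> nat \<Rightarrow>\<^sub>0 'k pol) \<Rightarrow> (nat \<Rightarrow>\<^sub>0 'y) \<Rightarrow> (nat \<Rightarrow>\<^sub>0 'y)" where
  "lin_ext sc t w = (\<Sum>g\<in>keys w. \<Sum>h\<in>keys (t g). single h (sc (lookup (t g) h) (lookup w g)))"

lemma bd_eq_ext: "p \<noteq> 0 \<Longrightarrow> bd Y F p = lin_ext (act Y) (diff F p)"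
  by (simp add: bd_def lin_ext_def fun_eq_iff)

lemma bd_Suc: "bd Y F (Suc p) = lin_ext (act Y) (diff F (Suc p))"
  by (simp add: bd_eq_ext)

lemma module_times: "module ((*) :: 'a::comm_ring_1 \<Rightarrow> 'a \<Rightarrow> 'a)"
  by unfold_locales (simp_all add: algebra_simps)

locale pol_module = module scale for scale :: "'k::field pol \<Rightarrow> 'y::ab_group_add \<Rightarrow> 'y" (infixr \<open>*s\<close> 75)
begin

lemma lookup_ext:
  assumes "finite G" "keys w \<subseteq> G"
  shows "lookup (lin_ext scale t w) h = (\<Sum>g\<in>G. lookup (t g) h *s lookup w g)"
proof -
  have "lookup (lin_ext scale t w) h = (\<Sum>g\<in>keys w. \<Sum>h'\<in>keys (t g).
      if h' = h then lookup (t g) h' *s lookup w g else 0)"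
    unfolding lin_ext_def by (simp add: lookup_sum lookup_single when_def)
  also have "\<dots> = (\<Sum>g\<in>keys w. lookup (t g) h *s lookup w g)"
    by (rule sum.cong) (auto simp: in_keys_iff)
  also have "\<dots> = (\<Sum>g\<in>G. lookup (t g) h *s lookup w g)"
    using assms by (intro sum.mono_neutral_left) (auto simp: in_keys_iff)
  finally show ?thesis .
qed

lemma lin_ext_add: "lin_ext scale t (v + w) = lin_ext scale t v + lin_ext scale t w"
proof (rule poly_mapping_eqI)
  fix h
  let ?G = "keys v \<union> keys w"
  have "keys (v + w) \<subseteq> ?G" by (rule keys_add)
  then show "lookup (lin_ext scale t (v + w)) h = lookup (lin_ext scale t v + lin_ext scale t w) h"
    by (simp add: lookup_ext[of ?G] lookup_add scale_right_distrib sum.distrib)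
qed

lemma lin_ext_diff: "lin_ext scale t (v - w) = lin_ext scale t v - lin_ext scale t w"
  using lin_ext_add[of t "v - w" w] by (simp add: algebra_simps)

lemma lin_ext_zero [simp]: "lin_ext scale t 0 = 0"
  by (simp add: lin_ext_def)

lemma lin_ext_diff_left: "lin_ext scale (\<lambda>g. s g - t g) w = lin_ext scale s w - lin_ext scale t w"
  by (rule poly_mapping_eqI)
    (simp add: lookup_ext[of "keys w"] lookup_minus scale_left_diff_distrib sum_subtractf)

lemma lin_ext_cong: "(\<And>g. g \<in> keys w \<Longrightarrow> s g = t g) \<Longrightarrow> lin_ext scale s w = lin_ext scale t w"
  by (simp add: lin_ext_def)

lemma lin_ext_single_one [simp]: "lin_ext scale (\<lambda>g. single g 1) w = w"
proof (rule poly_mapping_eqI)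
  fix h
  have "lookup (lin_ext scale (\<lambda>g. single g 1) w) h = (\<Sum>g\<in>keys w. if g = h then lookup w g else 0)"
    unfolding lookup_ext[OF finite_keys subset_refl]
    by (rule sum.cong) (auto simp: lookup_single when_def)
  also have "\<dots> = lookup w h" by (simp add: in_keys_iff)
  finally show "lookup (lin_ext scale (\<lambda>g. single g 1) w) h = lookup w h" .
qed

text \<open>Functoriality of tensoring with \<open>Y\<close>: the composite is induced by the matrix
  product, and that product is formed over \<open>S\<close>. This is what transports equations
  between matrices over \<open>S\<close> to any coefficient module.\<close>

lemma lin_ext_ext: "lin_ext scale t (lin_ext scale s w) = lin_ext scale (\<lambda>g. lin_ext (*) t (s g)) w"
proof (rule poly_mapping_eqI)
  fix h
  interpret T: pol_module "(*) :: 'k pol \<Rightarrow> 'k pol \<Rightarrow> 'k pol"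
    by (rule pol_module.intro[OF module_times])
  define G where "G = (\<Union>g\<in>keys w. keys (s g))"
  have fG: "finite G" by (simp add: G_def)
  have sub: "keys (lin_ext scale s w) \<subseteq> G"
  proof
    fix x assume "x \<in> keys (lin_ext scale s w)"
    then have "(\<Sum>g\<in>keys w. lookup (s g) x *s lookup w g) \<noteq> 0"
      by (simp add: in_keys_iff lookup_ext[of "keys w"])
    then obtain g where "g \<in> keys w" "lookup (s g) x *s lookup w g \<noteq> 0"
      by (rule sum.not_neutral_contains_not_neutral)
    moreover from this have "x \<in> keys (s g)" by (auto simp: in_keys_iff)
    ultimately show "x \<in> G" by (auto simp: G_def)
  qed
  have "lookup (lin_ext scale t (lin_ext scale s w)) h
      = (\<Sum>g'\<in>G. \<Sum>g\<in>keys w. (lookup (t g') h * lookup (s g) g') *s lookup w g)"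
    by (simp add: lookup_ext[OF fG sub] lookup_ext[of "keys w"] scale_sum_right)
  also have "\<dots> = (\<Sum>g\<in>keys w. (\<Sum>g'\<in>G. lookup (t g') h * lookup (s g) g') *s lookup w g)"
    by (subst sum.swap) (simp add: scale_sum_left)
  also have "\<dots> = (\<Sum>g\<in>keys w. lookup (lin_ext (*) t (s g)) h *s lookup w g)"
    by (intro sum.cong refl) (subst T.lookup_ext[OF fG], auto simp: G_def)
  finally show "lookup (lin_ext scale t (lin_ext scale s w)) h
      = lookup (lin_ext scale (\<lambda>g. lin_ext (*) t (s g)) w) h"
    by (simp add: lookup_ext[of "keys w"])
qed

end

section \<open>Degrees\<close>

lemma lookup_map_mult: "lookup (Poly_Mapping.map ((*) (c::'a::mult_zero)) v) r = c * lookup v r"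
  by transfer (simp add: when_def)

lemma lookup_monom_deg:
  assumes "finite G" "keys u \<subseteq> G"
  shows "lookup (monom_deg d m u) r = (\<Sum>i\<in>G. int (lookup u i) * lookup (avec d m i) r)"
proof -
  have "lookup (monom_deg d m u) r = (\<Sum>i\<in>keys u. int (lookup u i) * lookup (avec d m i) r)"
    by (simp add: monom_deg_def lookup_sum lookup_map_mult)
  also have "\<dots> = (\<Sum>i\<in>G. int (lookup u i) * lookup (avec d m i) r)"
    using assms by (intro sum.mono_neutral_left) (auto simp: in_keys_iff)
  finally show ?thesis .
qed

lemma monom_deg_zero [simp]: "monom_deg d m 0 = 0"
  by (simp add: monom_deg_def)

lemma monom_deg_add: "monom_deg d m (u + v) = monom_deg d m u + monom_deg d m v"
proof (rule poly_mapping_eqI)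
  fix r
  let ?G = "keys u \<union> keys v"
  have "keys (u + v) \<subseteq> ?G" by (rule keys_add)
  then show "lookup (monom_deg d m (u + v)) r = lookup (monom_deg d m u + monom_deg d m v) r"
    by (simp add: lookup_monom_deg[of ?G] lookup_add algebra_simps sum.distrib)
qed

lemma monom_deg_single [simp]: "monom_deg d m (single i 1) = avec d m i"
  by (rule poly_mapping_eqI) (simp add: lookup_monom_deg[of "{i}"])

lemma polyS_zero [simp]: "0 \<in> polyS d m"
  by (simp add: polyS_def)

lemma polyS_add: "f \<in> polyS d m \<Longrightarrow> g \<in> polyS d m \<Longrightarrow> f + g \<in> polyS d m"
  using keys_add[of f g] by (fastforce simp: polyS_def)

lemma keys_nat_add: "keys (u + v :: 'a \<Rightarrow>\<^sub>0 nat) = keys u \<union> keys v"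
  by (auto simp: in_keys_iff lookup_add)

lemma polyS_mult: "f \<in> polyS d m \<Longrightarrow> g \<in> polyS d m \<Longrightarrow> f * g \<in> polyS d m"
  using keys_mult[of f g] by (fastforce simp: polyS_def keys_nat_add)

lemma polyS_sum: "(\<And>i. i \<in> I \<Longrightarrow> f i \<in> polyS d m) \<Longrightarrow> sum f I \<in> polyS d m"
  by (induction I rule: infinite_finite_induct) (auto intro: polyS_add)

lemma polyS_uminus: "f \<in> polyS d m \<Longrightarrow> - f \<in> polyS d m"
  by (simp add: polyS_def)

abbreviation homS :: "nat \<Rightarrow> nat \<Rightarrow> vec \<Rightarrow> 'k::field pol set" where
  "homS d m \<equiv> comp (S_mod d m)"

lemma homS_iff: "f \<in> homS d m b \<longleftrightarrow> f \<in> polyS d m \<and> (\<forall>u\<in>keys f. monom_deg d m u = b)"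
  by (simp add: S_mod_def)

lemma act_S_mod [simp]: "act (S_mod d m) = (*)"
  by (simp add: S_mod_def)

lemma carr_S_mod [simp]: "carr (S_mod d m) = polyS d m"
  by (simp add: S_mod_def)

section \<open>Homogeneous components of polynomials\<close>

definition hpart :: "nat \<Rightarrow> nat \<Rightarrow> vec \<Rightarrow> 'k::field pol \<Rightarrow> 'k pol" where
  "hpart d m b f = (\<Sum>u\<in>{u\<in>keys f. monom_deg d m u = b}. single u (lookup f u))"

lemma lookup_hpart: "lookup (hpart d m b f) u = (if monom_deg d m u = b then lookup f u else 0)"
proof -
  have "lookup (hpart d m b f) u
      = (\<Sum>v\<in>{u\<in>keys f. monom_deg d m u = b}. if v = u then lookup f v else 0)"
    by (simp add: hpart_def lookup_sum lookup_single when_def)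
  also have "\<dots> = (if monom_deg d m u = b then lookup f u else 0)"
    by (auto simp: in_keys_iff)
  finally show ?thesis .
qed

lemma hpart_zero [simp]: "hpart d m b 0 = 0"
  by (rule poly_mapping_eqI) (simp add: lookup_hpart)

lemma hpart_add: "hpart d m b (f + g) = hpart d m b f + hpart d m b g"
  by (rule poly_mapping_eqI) (simp add: lookup_hpart lookup_add)

lemma hpart_sum: "hpart d m b (sum f I) = (\<Sum>i\<in>I. hpart d m b (f i))"
  by (induction I rule: infinite_finite_induct) (auto simp: hpart_add)

lemma hpart_in_homS: "f \<in> polyS d m \<Longrightarrow> hpart d m b f \<in> homS d m b"
  by (auto simp: homS_iff polyS_def in_keys_iff lookup_hpart split: if_splits)

lemma hpart_homS: "f \<in> homS d m b \<Longrightarrow> hpart d m b f = f"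
  by (rule poly_mapping_eqI) (auto simp: lookup_hpart homS_iff in_keys_iff)

text \<open>Split \<open>g\<close> into its component of degree \<open>b - a\<close> and the rest.
  Multiplication by \<open>f\<close> shifts degrees by \<open>a\<close>, so the first part
  contributes only in degree \<open>b\<close> and the rest contributes nothing there.\<close>

lemma hpart_mult:
  assumes "f \<in> homS d m a"
  shows "hpart d m b (f * g) = f * hpart d m (b - a) g"
proof -
  let ?g = "hpart d m (b - a) g"
  have "hpart d m b (f * ?g) = f * ?g"
  proof (rule poly_mapping_eqI)
    fix u
    have "monom_deg d m u = b" if "u \<in> keys (f * ?g)"
    proof -
      from that keys_mult[of f ?g] obtain v w
        where "u = v + w" "v \<in> keys f" "w \<in> keys ?g" by blast
      with assms show ?thesis
        by (auto simp: monom_deg_add homS_iff in_keys_iff lookup_hpart split: if_splits)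
    qed
    then show "lookup (hpart d m b (f * ?g)) u = lookup (f * ?g) u"
      by (auto simp: lookup_hpart in_keys_iff)
  qed
  moreover have "hpart d m b (f * (g - ?g)) = 0"
  proof (rule poly_mapping_eqI)
    fix u
    have "monom_deg d m u \<noteq> b" if "u \<in> keys (f * (g - ?g))"
    proof -
      from that keys_mult[of f "g - ?g"] obtain v w
        where "u = v + w" "v \<in> keys f" "w \<in> keys (g - ?g)" by blast
      with assms show ?thesis
        by (auto simp: monom_deg_add homS_iff in_keys_iff lookup_hpart lookup_minus split: if_splits)
    qed
    then show "lookup (hpart d m b (f * (g - ?g))) u = lookup 0 u"
      by (auto simp: lookup_hpart in_keys_iff)
  qed
  moreover have "f * g = f * ?g + f * (g - ?g)"
    by (simp add: algebra_simps)
  ultimately show ?thesis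
    by (simp add: hpart_add)
qed

text \<open>The action is defined on all polynomials, not only on those of \<open>polyS\<close>, and is a
  type-level module structure; only the grading refers to carriers.\<close>

locale graded_action =
  fixes d m :: nat and Y :: "('k::field, 'y::ab_group_add) graded_module"
  assumes module_act: "module (act Y)"
    and comp_zero: "0 \<in> comp Y b"
    and comp_add: "x \<in> comp Y b \<Longrightarrow> y \<in> comp Y b \<Longrightarrow> x + y \<in> comp Y b"
    and comp_act: "f \<in> homS d m a \<Longrightarrow> y \<in> comp Y b \<Longrightarrow> act Y f y \<in> comp Y (a + b)"
begin

sublocale pol_module "act Y" by (rule pol_module.intro[OF module_act])

lemma comp_sum: "(\<And>i. i \<in> I \<Longrightarrow> f i \<in> comp Y b) \<Longrightarrow> sum f I \<in> comp Y b"
  by (induction I rule: infinite_finite_induct) (auto intro: comp_zero comp_add)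

lemma chains_degD: "w \<in> chains_deg Y F p b \<Longrightarrow> lookup w g \<in> comp Y (b - gdeg F p g)"
  by (cases "g \<in> keys w") (auto simp: chains_deg_def in_keys_iff comp_zero)

lemma chains_deg_add:
  "v \<in> chains_deg Y F p b \<Longrightarrow> w \<in> chains_deg Y F p b \<Longrightarrow> v + w \<in> chains_deg Y F p b"
  using keys_add[of v w] by (fastforce simp: chains_deg_def lookup_add intro: comp_add)

lemma zero_chains_deg: "0 \<in> chains_deg Y F p b"
  by (simp add: chains_deg_def comp_zero)

lemma chains_deg_sum:
  "(\<And>i. i \<in> I \<Longrightarrow> f i \<in> chains_deg Y F p b) \<Longrightarrow> sum f I \<in> chains_deg Y F p b"
  by (induction I rule: infinite_finite_induct) (auto intro: zero_chains_deg chains_deg_add)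

end

lemma graded_action_S_mod: "graded_action d m (S_mod d m :: ('k::field, 'k pol) graded_module)"
proof (rule graded_action.intro)
  fix a b
  show "act (S_mod d m) f g \<in> homS d m (a + b)" if "f \<in> homS d m a" "g \<in> homS d m b" for f g :: "'k pol"
    using that keys_mult[of f g] by (fastforce simp: homS_iff monom_deg_add polyS_mult)
  show "f + g \<in> homS d m b" if "f \<in> homS d m b" "g \<in> homS d m b" for f g :: "'k pol"
    using that keys_add[of f g] by (fastforce simp: homS_iff polyS_add)
  show "module (act (S_mod d m :: ('k, 'k pol) graded_module))"
    by (simp add: module_times)
qed (simp add: homS_iff)

interpretation SA: graded_action d m "S_mod d m :: ('k::field, 'k pol) graded_module" for d m
  by (rule graded_action_S_mod)

lemma keys_diff_sub: "keys (f - g :: 'a \<Rightarrow>\<^sub>0 'b::ab_group_add) \<subseteq> keys f \<union> keys g"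
  by (auto simp: in_keys_iff lookup_minus)

lemma homS_diff: "f \<in> homS d m b \<Longrightarrow> g \<in> homS d m b \<Longrightarrow> f - g \<in> homS d m b"
  using keys_diff_sub[of f g] by (fastforce simp: homS_iff polyS_def)

section \<open>Comparison of resolutions\<close>

lemma chains_deg_subset_chains: "chains_deg (S_mod d m) F p b \<subseteq> chains (S_mod d m) F p"
  by (auto simp: chains_deg_def chains_def homS_iff)

lemma chainsD: "w \<in> chains (S_mod d m) F p \<Longrightarrow> lookup w g \<in> polyS d m"
  by (cases "g \<in> keys w") (auto simp: chains_def in_keys_iff)

text \<open>The degree of the generator \<open>g\<close> cancels: an entry of \<open>t g\<close> at
  \<open>h\<close> has degree \<open>gdeg F p g - gdeg G q h\<close>, and the coefficient of
  \<open>w\<close> at \<open>g\<close> has degree \<open>b - gdeg F p g\<close>.\<close>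

lemma (in graded_action) lin_ext_chains_deg:
  assumes "w \<in> chains_deg Y F p b"
    and "\<And>g. g \<in> gens F p \<Longrightarrow> t g \<in> chains_deg (S_mod d m) G q (gdeg F p g)"
  shows "lin_ext (act Y) t w \<in> chains_deg Y G q b"
proof -
  have gens: "g \<in> gens F p" if "g \<in> keys w" for g
    using assms(1) that by (auto simp: chains_deg_def)
  have "lookup (lin_ext (act Y) t w) h \<in> comp Y (b - gdeg G q h)" for h
  proof -
    have "act Y (lookup (t g) h) (lookup w g) \<in> comp Y ((gdeg F p g - gdeg G q h) + (b - gdeg F p g))"
      if "g \<in> keys w" for g
      using assms that gens by (intro comp_act SA.chains_degD chains_degD) auto
    then show ?thesis
      unfolding lookup_ext[OF finite_keys subset_refl] by (intro comp_sum) simp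
  qed
  moreover have "keys (lin_ext (act Y) t w) \<subseteq> gens G q"
  proof
    fix h assume "h \<in> keys (lin_ext (act Y) t w)"
    then have "(\<Sum>g\<in>keys w. act Y (lookup (t g) h) (lookup w g)) \<noteq> 0"
      by (simp add: in_keys_iff lookup_ext[of "keys w"])
    then obtain g where g: "g \<in> keys w" "act Y (lookup (t g) h) (lookup w g) \<noteq> 0"
      by (rule sum.not_neutral_contains_not_neutral)
    then have "h \<in> keys (t g)" by (auto simp: in_keys_iff)
    with assms(2)[OF gens[OF g(1)]] show "h \<in> gens G q"
      by (auto simp: chains_deg_def)
  qed
  ultimately show ?thesis by (simp add: chains_deg_def)
qed

lemma lin_ext_chains:
  assumes "w \<in> chains (S_mod d m) F p"
    and "\<And>g. g \<in> gens F p \<Longrightarrow> t g \<in> chains (S_mod d m) G q"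
  shows "lin_ext (*) t w \<in> chains (S_mod d m) G q"
proof -
  have gens: "g \<in> gens F p" if "g \<in> keys w" for g
    using assms(1) that by (auto simp: chains_def)
  note le = SA.lookup_ext[OF finite_keys subset_refl, unfolded act_S_mod]
  have "lookup (lin_ext (*) t w) h \<in> polyS d m" for h
    unfolding le using assms gens by (intro polyS_sum polyS_mult chainsD) auto
  moreover have "keys (lin_ext (*) t w) \<subseteq> gens G q"
  proof
    fix h assume "h \<in> keys (lin_ext (*) t w)"
    then have "(\<Sum>g\<in>keys w. lookup (t g) h * lookup w g) \<noteq> 0"
      by (simp add: in_keys_iff le)
    then obtain g where g: "g \<in> keys w" "lookup (t g) h * lookup w g \<noteq> 0"
      by (rule sum.not_neutral_contains_not_neutral)
    then have "h \<in> keys (t g)" by (auto simp: in_keys_iff)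
    with assms(2)[OF gens[OF g(1)]] show "h \<in> gens G q"
      by (auto simp: chains_def)
  qed
  ultimately show ?thesis by (simp add: chains_def)
qed

lemma lin_ext_single: "lin_ext (*) t (single g 1) = t g"
  by (rule poly_mapping_eqI) (simp add: SA.lookup_ext[unfolded act_S_mod, of "{g}"])

text \<open>Exactness of a resolution is required for whole modules, without reference to degrees.
  This projection commutes with all degree-preserving maps and thereby yields exactness of each
  single strand.\<close>

definition hproj ::
    "nat \<Rightarrow> nat \<Rightarrow> ('k::field, 'a) free_complex \<Rightarrow> nat \<Rightarrow> vec \<Rightarrow> (nat \<Rightarrow>\<^sub>0 'k pol) \<Rightarrow> (nat \<Rightarrow>\<^sub>0 'k pol)" where
  "hproj d m F p b w = (\<Sum>g\<in>keys w. single g (hpart d m (b - gdeg F p g) (lookup w g)))"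

lemma lookup_hproj: "lookup (hproj d m F p b w) g = hpart d m (b - gdeg F p g) (lookup w g)"
proof -
  have "lookup (hproj d m F p b w) g
      = (\<Sum>h\<in>keys w. if h = g then hpart d m (b - gdeg F p h) (lookup w h) else 0)"
    by (simp add: hproj_def lookup_sum lookup_single when_def)
  also have "\<dots> = hpart d m (b - gdeg F p g) (lookup w g)"
    by (auto simp: in_keys_iff)
  finally show ?thesis .
qed

lemma keys_hproj: "keys (hproj d m F p b w) \<subseteq> keys w"
  by (auto simp: in_keys_iff lookup_hproj)

lemma hproj_chains_deg:
  "w \<in> chains (S_mod d m) F p \<Longrightarrow> hproj d m F p b w \<in> chains_deg (S_mod d m) F p b"
  using keys_hproj[of d m F p b w]
  by (auto simp: chains_def chains_deg_def lookup_hproj intro!: hpart_in_homS)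

lemma hproj_ident: "w \<in> chains_deg (S_mod d m) F p b \<Longrightarrow> hproj d m F p b w = w"
  by (rule poly_mapping_eqI) (auto simp: lookup_hproj intro: hpart_homS SA.chains_degD)

lemma hproj_ext:
  assumes "w \<in> chains (S_mod d m) F p"
    and "\<And>g. g \<in> gens F p \<Longrightarrow> t g \<in> chains_deg (S_mod d m) G q (gdeg F p g)"
  shows "hproj d m G q b (lin_ext (*) t w) = lin_ext (*) t (hproj d m F p b w)"
proof (rule poly_mapping_eqI)
  fix h
  note le = SA.lookup_ext[unfolded act_S_mod, OF finite_keys]
  have "lookup (hproj d m G q b (lin_ext (*) t w)) h
      = (\<Sum>g\<in>keys w. hpart d m (b - gdeg G q h) (lookup (t g) h * lookup w g))"
    by (simp add: lookup_hproj le[OF subset_refl] hpart_sum)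
  also have "\<dots> = (\<Sum>g\<in>keys w. lookup (t g) h * hpart d m (b - gdeg F p g) (lookup w g))"
  proof (intro sum.cong refl)
    fix g assume "g \<in> keys w"
    then have "t g \<in> chains_deg (S_mod d m) G q (gdeg F p g)"
      using assms by (auto simp: chains_def)
    from hpart_mult[OF SA.chains_degD[OF this]]
    show "hpart d m (b - gdeg G q h) (lookup (t g) h * lookup w g)
        = lookup (t g) h * hpart d m (b - gdeg F p g) (lookup w g)"
      by simp
  qed
  also have "\<dots> = lookup (lin_ext (*) t (hproj d m F p b w)) h"
    by (simp add: le[OF keys_hproj] lookup_hproj)
  finally show "lookup (hproj d m G q b (lin_ext (*) t w)) h
      = lookup (lin_ext (*) t (hproj d m F p b w)) h" .
qed

text \<open>Exponents are natural numbers, so a product of monomials is constant only if both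
  factors are. Hence taking the constant coefficient is multiplicative, which makes the augmentation
  to \<open>k\<close> linear over \<open>S\<close>.\<close>

lemma lookup_mult_zero: "lookup (f * g :: 'k::field pol) 0 = lookup f 0 * lookup g 0"
proof -
  have sum0: "a + b = 0 \<longleftrightarrow> a = 0 \<and> b = 0" for a b :: "nat \<Rightarrow>\<^sub>0 nat"
    by (auto simp: poly_mapping_eq_iff fun_eq_iff lookup_add)
  have "lookup (f * g) 0 = (\<Sum>l. lookup f l * (\<Sum>q. lookup g q when 0 = l + q))"
    by (rule lookup_mult)
  also have "\<dots> = (\<Sum>l. lookup f l * lookup g 0 when l = 0)"
  proof (rule Sum_any.cong)
    fix l :: "nat \<Rightarrow>\<^sub>0 nat"
    show "lookup f l * (\<Sum>q. lookup g q when 0 = l + q) = (lookup f l * lookup g 0 when l = 0)"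
    proof (cases "l = 0")
      case False
      then have "0 \<noteq> l + q" for q using sum0[of l q] by metis
      with False show ?thesis by simp
    qed simp
  qed
  finally show ?thesis by simp
qed

lemma aug_map_k: "finite G \<Longrightarrow> keys w \<subseteq> G \<Longrightarrow>
    aug_map k_mod F w = (\<Sum>g\<in>G. lookup (lookup w g) 0 * aug F g)"
  by (auto simp: aug_map_def k_mod_def in_keys_iff intro!: sum.mono_neutral_left)

lemma aug_map_k_diff: "aug_map k_mod F (v - w) = aug_map k_mod F v - aug_map k_mod F w"
  using keys_diff_sub[of v w]
  by (simp add: aug_map_k[of "keys v \<union> keys w"] lookup_minus left_diff_distrib sum_subtractf)

lemma aug_map_k_ext:
  "aug_map k_mod G (lin_ext (*) t w) = (\<Sum>g\<in>keys w. lookup (lookup w g) 0 * aug_map k_mod G (t g))"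
proof -
  define H where "H = (\<Union>g\<in>keys w. keys (t g)) \<union> keys (lin_ext (*) t w)"
  have fH: "finite H" by (simp add: H_def)
  have "aug_map k_mod G (lin_ext (*) t w)
      = (\<Sum>h\<in>H. \<Sum>g\<in>keys w. lookup (lookup (t g) h) 0 * lookup (lookup w g) 0 * aug G h)"
    by (subst aug_map_k[OF fH])
      (simp_all add: H_def SA.lookup_ext[unfolded act_S_mod, OF finite_keys subset_refl]
        lookup_sum lookup_mult_zero sum_distrib_right)
  also have "\<dots> = (\<Sum>g\<in>keys w. \<Sum>h\<in>H. lookup (lookup (t g) h) 0 * lookup (lookup w g) 0 * aug G h)"
    by (rule sum.swap)
  also have "\<dots> = (\<Sum>g\<in>keys w. lookup (lookup w g) 0 * aug_map k_mod G (t g))"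
  proof (intro sum.cong refl)
    fix g assume "g \<in> keys w"
    then have "keys (t g) \<subseteq> H" by (auto simp: H_def)
    then show "(\<Sum>h\<in>H. lookup (lookup (t g) h) 0 * lookup (lookup w g) 0 * aug G h)
        = lookup (lookup w g) 0 * aug_map k_mod G (t g)"
      by (simp add: aug_map_k[OF fH] sum_distrib_left mult_ac)
  qed
  finally show ?thesis .
qed

lemma aug_map_k_single: "aug_map k_mod F (single g 1) = aug F g"
  by (simp add: aug_map_k[of "{g}"])

section \<open>Graded resolutions of \<open>k\<close> and liftings along them\<close>

locale k_resolution =
  fixes d m :: nat and F :: "('k::field, 'k) free_complex"
  assumes resolution: "graded_free_resolution d m k_mod F"
begin

text \<open>In position 0 the augmentation takes the place of the differential, so that a single
  exactness statement covers all positions and the inductive liftings need no case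
  distinction.\<close>

definition cycle :: "nat \<Rightarrow> (nat \<Rightarrow>\<^sub>0 'k pol) \<Rightarrow> bool" where
  "cycle p w \<longleftrightarrow> (if p = 0 then aug_map k_mod F w = 0 else lin_ext (*) (diff F p) w = 0)"

lemma diff_deg:
  "g \<in> gens F (Suc p) \<Longrightarrow> diff F (Suc p) g \<in> chains_deg (S_mod d m) F p (gdeg F (Suc p) g)"
  using resolution by (simp add: graded_free_resolution_def)

lemma aug_deg: "g \<in> gens F 0 \<Longrightarrow> gdeg F 0 g \<noteq> 0 \<Longrightarrow> aug F g = 0"
  using resolution by (auto simp: graded_free_resolution_def k_mod_def split: if_splits)

lemma cycles_eq:
  "{w \<in> chains (S_mod d m) F p. cycle p w}
    = lin_ext (*) (diff F (Suc p)) ` chains (S_mod d m) F (Suc p)"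
proof (cases p)
  case 0
  then show ?thesis
    using resolution by (simp add: graded_free_resolution_def cycle_def bd_eq_ext)
next
  case (Suc q)
  then have "{w \<in> chains (S_mod d m) F p. bd (S_mod d m) F p w = 0}
      = bd (S_mod d m) F (p + 1) ` chains (S_mod d m) F (p + 1)"
    using resolution by (simp add: graded_free_resolution_def)
  with Suc show ?thesis by (simp add: cycle_def bd_eq_ext)
qed

lemma cycle_boundary: "w \<in> chains (S_mod d m) F (Suc p) \<Longrightarrow> cycle p (lin_ext (*) (diff F (Suc p)) w)"
  using cycles_eq[of p] by auto

lemma gen_chain: "g \<in> gens F p \<Longrightarrow> single g 1 \<in> chains_deg (S_mod d m) F p (gdeg F p g)"
  by (auto simp: chains_deg_def lookup_single when_def homS_iff polyS_def)

lemma cycle_diff: "g \<in> gens F (Suc p) \<Longrightarrow> cycle p (diff F (Suc p) g)"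
proof -
  assume g: "g \<in> gens F (Suc p)"
  have "single g 1 \<in> chains (S_mod d m) F (Suc p)"
    using gen_chain[OF g] chains_deg_subset_chains by blast
  from cycle_boundary[OF this] show ?thesis
    by (simp add: lin_ext_single)
qed

lemma exact_deg:
  assumes "z \<in> chains_deg (S_mod d m) F p c" "cycle p z"
  shows "\<exists>y\<in>chains_deg (S_mod d m) F (Suc p) c. lin_ext (*) (diff F (Suc p)) y = z"
proof -
  from assms have "z \<in> {w \<in> chains (S_mod d m) F p. cycle p w}"
    using chains_deg_subset_chains by blast
  then obtain y where y: "y \<in> chains (S_mod d m) F (Suc p)" "lin_ext (*) (diff F (Suc p)) y = z"
    unfolding cycles_eq by auto
  \<comment> \<open>The preimage \<open>y\<close> may be inhomogeneous; as \<open>z\<close> is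
    homogeneous of degree \<open>c\<close>, the component of \<open>y\<close> in that degree already
    has image \<open>z\<close>.\<close>
  have "lin_ext (*) (diff F (Suc p)) (hproj d m F (Suc p) c y) = hproj d m F p c z"
    using hproj_ext[OF y(1), of "diff F (Suc p)" F p c] diff_deg y(2) by simp
  with assms(1) have "lin_ext (*) (diff F (Suc p)) (hproj d m F (Suc p) c y) = z"
    by (simp add: hproj_ident)
  with hproj_chains_deg[OF y(1)] show ?thesis by blast
qed

text \<open>Since \<open>k\<close> lives in degree 0, generators of non-zero degree have
  augmentation 0. So replacing a preimage by its component of degree 0 does not change the
  augmentation.\<close>

lemma aug_surj: "\<exists>w\<in>chains_deg (S_mod d m) F 0 0. aug_map k_mod F w = y"
proof -
  have "aug_map k_mod F ` chains (S_mod d m) F 0 = UNIV"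
    using resolution by (simp add: graded_free_resolution_def k_mod_def)
  then obtain w where w: "w \<in> chains (S_mod d m) F 0" "aug_map k_mod F w = y"
    by (metis UNIV_I imageE)
  let ?w = "hproj d m F 0 0 w"
  have "aug_map k_mod F ?w = (\<Sum>g\<in>keys w. lookup (lookup ?w g) 0 * aug F g)"
    by (rule aug_map_k) (simp_all add: keys_hproj)
  also have "\<dots> = (\<Sum>g\<in>keys w. lookup (lookup w g) 0 * aug F g)"
  proof (intro sum.cong refl)
    fix g assume "g \<in> keys w"
    with w(1) have "g \<in> gens F 0" by (auto simp: chains_def)
    with aug_deg[of g] show "lookup (lookup ?w g) 0 * aug F g = lookup (lookup w g) 0 * aug F g"
      by (cases "gdeg F 0 g = 0") (auto simp: lookup_hproj lookup_hpart)
  qed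
  also have "\<dots> = y" using w(2) by (simp add: aug_map_k[of "keys w"])
  finally show ?thesis using hproj_chains_deg[OF w(1)] by blast
qed

end

locale k_resolution_pair = F: k_resolution d m F + G: k_resolution d m G
  for d m :: nat and F G :: "('k::field, 'k) free_complex"
begin

definition chain_map :: "(nat \<Rightarrow> nat \<Rightarrow> (nat \<Rightarrow>\<^sub>0 'k pol)) \<Rightarrow> bool" where
  "chain_map \<phi> \<longleftrightarrow>
    (\<forall>p. \<forall>g\<in>gens F p. \<phi> p g \<in> chains_deg (S_mod d m) G p (gdeg F p g)) \<and>
    (\<forall>g\<in>gens F 0. aug_map k_mod G (\<phi> 0 g) = aug F g) \<and>
    (\<forall>p. \<forall>g\<in>gens F (Suc p). lin_ext (*) (diff G (Suc p)) (\<phi> (Suc p) g) = lin_ext (*) (\<phi> p) (diff F (Suc p) g))"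

lemma aug_map_k_ext_eq:
  assumes "\<And>g. g \<in> gens F 0 \<Longrightarrow> aug_map k_mod G (t g) = aug F g" "w \<in> chains (S_mod d m) F 0"
  shows "aug_map k_mod G (lin_ext (*) t w) = aug_map k_mod F w"
proof -
  have "keys w \<subseteq> gens F 0" using assms(2) by (simp add: chains_def)
  then have "(\<Sum>g\<in>keys w. lookup (lookup w g) 0 * aug_map k_mod G (t g))
      = (\<Sum>g\<in>keys w. lookup (lookup w g) 0 * aug F g)"
    using assms(1) by (intro sum.cong) auto
  then show ?thesis by (simp add: aug_map_k_ext aug_map_k[of "keys w" w F])
qed

lemma chain_map_exists: "\<exists>\<phi>. chain_map \<phi>"
proof -
  \<comment> \<open>The last clause, that cycles go to cycles, is what makes the next lifting
    possible: the image of \<open>diff F (Suc p) g\<close> is then a cycle of \<open>G\<close>,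
    hence a boundary. \<open>Q\<close> links consecutive stages as required by dependent
    choice.\<close>
  define P where "P p f \<longleftrightarrow>
      (\<forall>g\<in>gens F p. f g \<in> chains_deg (S_mod d m) G p (gdeg F p g)) \<and>
      (p = 0 \<longrightarrow> (\<forall>g\<in>gens F 0. aug_map k_mod G (f g) = aug F g)) \<and>
      (\<forall>w\<in>chains (S_mod d m) F p. F.cycle p w \<longrightarrow> G.cycle p (lin_ext (*) f w))"
    for p and f :: "nat \<Rightarrow> (nat \<Rightarrow>\<^sub>0 'k pol)"
  define Q where "Q p f f' \<longleftrightarrow>
      (\<forall>g\<in>gens F (Suc p). lin_ext (*) (diff G (Suc p)) (f' g) = lin_ext (*) f (diff F (Suc p) g))"
    for p and f f' :: "nat \<Rightarrow> (nat \<Rightarrow>\<^sub>0 'k pol)"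
  have "\<exists>f. P 0 f"
  proof -
    have "\<exists>w. w \<in> chains_deg (S_mod d m) G 0 (gdeg F 0 g) \<and> aug_map k_mod G w = aug F g"
      if g: "g \<in> gens F 0" for g
    proof (cases "gdeg F 0 g = 0")
      case True
      then show ?thesis using G.aug_surj by auto
    next
      \<comment> \<open>A generator of non-zero degree has augmentation 0, so it may be sent to
        0.\<close>
      case False
      with F.aug_deg[OF g] show ?thesis
        by (intro exI[of _ 0]) (auto simp: SA.zero_chains_deg aug_map_def)
    qed
    then obtain f where "\<forall>g\<in>gens F 0.
        f g \<in> chains_deg (S_mod d m) G 0 (gdeg F 0 g) \<and> aug_map k_mod G (f g) = aug F g"
      by metis
    then have "P 0 f"
      by (auto simp: P_def F.cycle_def G.cycle_def aug_map_k_ext_eq)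
    then show ?thesis by blast
  qed
  moreover have "\<exists>f'. P (Suc p) f' \<and> Q p f f'" if P: "P p f" for p f
  proof -
    have "\<exists>y. y \<in> chains_deg (S_mod d m) G (Suc p) (gdeg F (Suc p) g) \<and>
        lin_ext (*) (diff G (Suc p)) y = lin_ext (*) f (diff F (Suc p) g)"
      if g: "g \<in> gens F (Suc p)" for g
    proof -
      have "lin_ext (*) f (diff F (Suc p) g) \<in> chains_deg (S_mod d m) G p (gdeg F (Suc p) g)"
        using P F.diff_deg[OF g] SA.lin_ext_chains_deg[of "diff F (Suc p) g" d m F p _ f G p]
        by (auto simp: P_def)
      moreover have "G.cycle p (lin_ext (*) f (diff F (Suc p) g))"
        using P F.diff_deg[OF g] F.cycle_diff[OF g] chains_deg_subset_chains
        unfolding P_def by blast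
      ultimately show ?thesis using G.exact_deg by blast
    qed
    then obtain f' where f': "\<forall>g\<in>gens F (Suc p).
        f' g \<in> chains_deg (S_mod d m) G (Suc p) (gdeg F (Suc p) g) \<and>
        lin_ext (*) (diff G (Suc p)) (f' g) = lin_ext (*) f (diff F (Suc p) g)"
      by metis
    have "G.cycle (Suc p) (lin_ext (*) f' w)"
      if w: "w \<in> chains (S_mod d m) F (Suc p)" "F.cycle (Suc p) w" for w
    proof -
      have "lin_ext (*) (diff G (Suc p)) (lin_ext (*) f' w) = lin_ext (*) f (lin_ext (*) (diff F (Suc p)) w)"
        unfolding SA.lin_ext_ext[unfolded act_S_mod]
        using w(1) f' by (intro SA.lin_ext_cong[unfolded act_S_mod]) (auto simp: chains_def)
      with w(2) show ?thesis
        by (simp add: F.cycle_def G.cycle_def SA.lin_ext_zero[unfolded act_S_mod])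
    qed
    with f' have "P (Suc p) f' \<and> Q p f f'" by (auto simp: P_def Q_def)
    then show ?thesis by blast
  qed
  ultimately obtain \<phi> where "\<And>p. P p (\<phi> p) \<and> Q p (\<phi> p) (\<phi> (Suc p))"
    using dependent_nat_choice[of P Q] by blast
  then have "chain_map \<phi>"
    by (auto simp: chain_map_def P_def Q_def)
  then show ?thesis by blast
qed

end

text \<open>An endomorphism of the resolution lying over the identity of \<open>k\<close> is
  homotopic to the identity: at each stage the part of the homotopy identity still to be realised is
  a cycle, hence a boundary.\<close>

lemma (in k_resolution) homotopy_exists:
  assumes "k_resolution_pair.chain_map d m F F \<theta>"
  shows "\<exists>h. (\<forall>p. \<forall>g\<in>gens F p. h p g \<in> chains_deg (S_mod d m) F (Suc p) (gdeg F p g)) \<and>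
    (\<forall>g\<in>gens F 0. lin_ext (*) (diff F (Suc 0)) (h 0 g) = single g 1 - \<theta> 0 g) \<and>
    (\<forall>p. \<forall>g\<in>gens F (Suc p). lin_ext (*) (diff F (Suc (Suc p))) (h (Suc p) g)
        = single g 1 - \<theta> (Suc p) g - lin_ext (*) (h p) (diff F (Suc p) g))"
proof -
  interpret k_resolution_pair d m F F ..
  note e = SA.lin_ext_diff[unfolded act_S_mod] SA.lin_ext_zero[unfolded act_S_mod]
    SA.lin_ext_ext[unfolded act_S_mod] SA.lin_ext_diff_left[unfolded act_S_mod]
    SA.lin_ext_single_one[unfolded act_S_mod]
  have theta: "g \<in> gens F p \<Longrightarrow> \<theta> p g \<in> chains_deg (S_mod d m) F p (gdeg F p g)"
    "g \<in> gens F 0 \<Longrightarrow> aug_map k_mod F (\<theta> 0 g) = aug F g"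
    "g \<in> gens F (Suc p) \<Longrightarrow> lin_ext (*) (diff F (Suc p)) (\<theta> (Suc p) g) = lin_ext (*) (\<theta> p) (diff F (Suc p) g)"
    for p g
    using assms by (auto simp: chain_map_def)
  have sub: "u - v \<in> chains_deg (S_mod d m) F p c"
    if "u \<in> chains_deg (S_mod d m) F p c" "v \<in> chains_deg (S_mod d m) F p c" for u v p c
    using that keys_diff_sub[of u v] by (auto simp: chains_deg_def lookup_minus intro: homS_diff)
  \<comment> \<open>On a cycle \<open>w\<close> the term that applies the preceding homotopy to the
    boundary of \<open>w\<close> vanishes, which leaves the identity in the last clause. Used for
    \<open>diff F (Suc p) g\<close>, it shows that the right-hand side in \<open>Q\<close> is a
    cycle.\<close>
  define P where "P p f \<longleftrightarrow>
      (\<forall>g\<in>gens F p. f g \<in> chains_deg (S_mod d m) F (Suc p) (gdeg F p g)) \<and>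
      (p = 0 \<longrightarrow> (\<forall>g\<in>gens F 0. lin_ext (*) (diff F (Suc 0)) (f g) = single g 1 - \<theta> 0 g)) \<and>
      (\<forall>w\<in>chains (S_mod d m) F p. cycle p w \<longrightarrow>
        lin_ext (*) (diff F (Suc p)) (lin_ext (*) f w) = w - lin_ext (*) (\<theta> p) w)"
    for p f
  define Q where "Q p f f' \<longleftrightarrow> (\<forall>g\<in>gens F (Suc p). lin_ext (*) (diff F (Suc (Suc p))) (f' g)
        = single g 1 - \<theta> (Suc p) g - lin_ext (*) f (diff F (Suc p) g))"
    for p f f'
  have "\<exists>f. P 0 f"
  proof -
    have "\<exists>y. y \<in> chains_deg (S_mod d m) F (Suc 0) (gdeg F 0 g) \<and>
        lin_ext (*) (diff F (Suc 0)) y = single g 1 - \<theta> 0 g"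
      if g: "g \<in> gens F 0" for g
    proof -
      have "cycle 0 (single g 1 - \<theta> 0 g)"
        using theta(2)[OF g] by (simp add: cycle_def aug_map_k_diff aug_map_k_single)
      with exact_deg sub[OF gen_chain[OF g] theta(1)[OF g]] show ?thesis by blast
    qed
    then obtain f where f: "\<forall>g\<in>gens F 0. f g \<in> chains_deg (S_mod d m) F (Suc 0) (gdeg F 0 g) \<and>
        lin_ext (*) (diff F (Suc 0)) (f g) = single g 1 - \<theta> 0 g"
      by metis
    have "lin_ext (*) (diff F (Suc 0)) (lin_ext (*) f w) = w - lin_ext (*) (\<theta> 0) w"
      if w: "w \<in> chains (S_mod d m) F 0" for w
    proof -
      have "lin_ext (*) (diff F (Suc 0)) (lin_ext (*) f w) = lin_ext (*) (\<lambda>g. single g 1 - \<theta> 0 g) w"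
        unfolding e(3) using w f by (intro SA.lin_ext_cong[unfolded act_S_mod]) (auto simp: chains_def)
      then show ?thesis by (simp add: e)
    qed
    with f have "P 0 f" by (auto simp: P_def)
    then show ?thesis by blast
  qed
  moreover have "\<exists>f'. P (Suc p) f' \<and> Q p f f'" if P: "P p f" for p f
  proof -
    have "\<exists>y. y \<in> chains_deg (S_mod d m) F (Suc (Suc p)) (gdeg F (Suc p) g) \<and>
        lin_ext (*) (diff F (Suc (Suc p))) y = single g 1 - \<theta> (Suc p) g - lin_ext (*) f (diff F (Suc p) g)"
      if g: "g \<in> gens F (Suc p)" for g
    proof -
      let ?z = "single g 1 - \<theta> (Suc p) g - lin_ext (*) f (diff F (Suc p) g)"
      have "lin_ext (*) f (diff F (Suc p) g) \<in> chains_deg (S_mod d m) F (Suc p) (gdeg F (Suc p) g)"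
        using P diff_deg[OF g] SA.lin_ext_chains_deg[of "diff F (Suc p) g" d m F p _ f F "Suc p"]
        by (auto simp: P_def)
      then have "?z \<in> chains_deg (S_mod d m) F (Suc p) (gdeg F (Suc p) g)"
        using gen_chain[OF g] theta(1)[OF g] by (intro sub)
      moreover have "lin_ext (*) (diff F (Suc p)) (lin_ext (*) f (diff F (Suc p) g))
          = diff F (Suc p) g - lin_ext (*) (\<theta> p) (diff F (Suc p) g)"
        using P diff_deg[OF g] cycle_diff[OF g] chains_deg_subset_chains
        unfolding P_def by blast
      then have "cycle (Suc p) ?z"
        using theta(3)[OF g] by (simp add: cycle_def e(1) lin_ext_single)
      ultimately show ?thesis using exact_deg by blast
    qed
    then obtain f' where f': "\<forall>g\<in>gens F (Suc p).
        f' g \<in> chains_deg (S_mod d m) F (Suc (Suc p)) (gdeg F (Suc p) g) \<and>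
        lin_ext (*) (diff F (Suc (Suc p))) (f' g)
          = single g 1 - \<theta> (Suc p) g - lin_ext (*) f (diff F (Suc p) g)"
      by metis
    have "lin_ext (*) (diff F (Suc (Suc p))) (lin_ext (*) f' w) = w - lin_ext (*) (\<theta> (Suc p)) w"
      if w: "w \<in> chains (S_mod d m) F (Suc p)" "cycle (Suc p) w" for w
    proof -
      have "lin_ext (*) (diff F (Suc (Suc p))) (lin_ext (*) f' w)
          = lin_ext (*) (\<lambda>g. single g 1 - \<theta> (Suc p) g - lin_ext (*) f (diff F (Suc p) g)) w"
        unfolding e(3) using w f' by (intro SA.lin_ext_cong[unfolded act_S_mod]) (auto simp: chains_def)
      also have "\<dots> = w - lin_ext (*) (\<theta> (Suc p)) w - lin_ext (*) f (lin_ext (*) (diff F (Suc p)) w)"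
        by (simp add: e)
      finally show ?thesis using w(2) by (simp add: cycle_def e(2))
    qed
    with f' have "P (Suc p) f' \<and> Q p f f'" by (auto simp: P_def Q_def)
    then show ?thesis by blast
  qed
  ultimately obtain h where "\<And>p. P p (h p) \<and> Q p (h p) (h (Suc p))"
    using dependent_nat_choice[of P Q] by blast
  then show ?thesis
    by (intro exI[of _ h]) (auto simp: P_def Q_def)
qed

text \<open>As \<open>bd\<close> is 0 in position 0, every chain there counts as a cycle; so the
  homology in position 0 is included among those that vanish.\<close>

definition acyclic_deg ::
    "('k::field, 'y::ab_group_add) graded_module \<Rightarrow> ('k, 'a) free_complex \<Rightarrow> vec \<Rightarrow> bool" where
  "acyclic_deg Y F b \<longleftrightarrow> (\<forall>p. \<forall>z\<in>chains_deg Y F p b. bd Y F p z = 0 \<longrightarrow>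
     (\<exists>y\<in>chains_deg Y F (Suc p) b. bd Y F (Suc p) y = z))"

text \<open>With \<open>\<phi>\<close> from \<open>F\<close> to \<open>G\<close>,
  \<open>\<psi>\<close> back, and \<open>h\<close> a homotopy between the identity and their
  composite, a cycle \<open>z\<close> equals the boundary of \<open>h z\<close> plus
  \<open>\<psi> (\<phi> z)\<close>. The cycle \<open>\<phi> z\<close> bounds some \<open>y\<close>
  over \<open>G\<close>, so \<open>z\<close> is the boundary of
  \<open>\<psi> y + h z\<close>.\<close>

theorem acyclic_deg_transfer:
  fixes F G :: "('k::field, 'k) free_complex"
  assumes "k_resolution d m F" "k_resolution d m G" "graded_action d m Y"
    and acyc: "acyclic_deg Y G b"
  shows "acyclic_deg Y F b"
proof -
  interpret F: k_resolution d m F by fact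
  interpret G: k_resolution d m G by fact
  interpret FG: k_resolution_pair d m F G ..
  interpret GF: k_resolution_pair d m G F ..
  interpret FF: k_resolution_pair d m F F ..
  interpret graded_action d m Y by fact
  obtain \<phi> where "FG.chain_map \<phi>" using FG.chain_map_exists ..
  then have phi: "g \<in> gens F p \<Longrightarrow> \<phi> p g \<in> chains_deg (S_mod d m) G p (gdeg F p g)"
    "g \<in> gens F 0 \<Longrightarrow> aug_map k_mod G (\<phi> 0 g) = aug F g"
    "g \<in> gens F (Suc p) \<Longrightarrow> lin_ext (*) (diff G (Suc p)) (\<phi> (Suc p) g) = lin_ext (*) (\<phi> p) (diff F (Suc p) g)"
    for p g by (auto simp: FG.chain_map_def)
  obtain \<psi> where "GF.chain_map \<psi>" using GF.chain_map_exists ..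
  then have psi: "g \<in> gens G p \<Longrightarrow> \<psi> p g \<in> chains_deg (S_mod d m) F p (gdeg G p g)"
    "g \<in> gens G 0 \<Longrightarrow> aug_map k_mod F (\<psi> 0 g) = aug G g"
    "g \<in> gens G (Suc p) \<Longrightarrow> lin_ext (*) (diff F (Suc p)) (\<psi> (Suc p) g) = lin_ext (*) (\<psi> p) (diff G (Suc p) g)"
    for p g by (auto simp: GF.chain_map_def)
  define \<theta> where "\<theta> p g = lin_ext (*) (\<psi> p) (\<phi> p g)" for p g
  have lin_ext_cong_chain: "lin_ext (act Y) s w = lin_ext (act Y) t w"
    if "w \<in> chains_deg Y H p c" "\<And>g. g \<in> gens H p \<Longrightarrow> s g = t g"
    for s t w p c and H :: "('k, 'k) free_complex"
    using that by (intro lin_ext_cong) (auto simp: chains_deg_def)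
  have lin_ext_cong_S: "lin_ext (*) s w = lin_ext (*) t w"
    if "w \<in> chains_deg (S_mod d m) H p c" "\<And>g. g \<in> gens H p \<Longrightarrow> s g = t g"
    for s t w p c and H :: "('k, 'k) free_complex"
    using that by (intro SA.lin_ext_cong[unfolded act_S_mod]) (auto simp: chains_deg_def)
  have "FF.chain_map \<theta>"
    unfolding FF.chain_map_def
  proof (intro conjI allI ballI)
    fix p g assume "g \<in> gens F p"
    then show "\<theta> p g \<in> chains_deg (S_mod d m) F p (gdeg F p g)"
      unfolding \<theta>_def by (intro SA.lin_ext_chains_deg[unfolded act_S_mod, OF phi(1) psi(1)])
  next
    fix g assume g: "g \<in> gens F 0"
    then show "aug_map k_mod F (\<theta> 0 g) = aug F g"
      unfolding \<theta>_def using phi(1,2)[OF g] psi(2) chains_deg_subset_chains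
      by (subst GF.aug_map_k_ext_eq) (auto dest: subsetD[OF chains_deg_subset_chains])
  next
    fix p g assume g: "g \<in> gens F (Suc p)"
    have "lin_ext (*) (diff F (Suc p)) (\<theta> (Suc p) g)
        = lin_ext (*) (\<psi> p) (lin_ext (*) (diff G (Suc p)) (\<phi> (Suc p) g))"
      unfolding \<theta>_def SA.lin_ext_ext[unfolded act_S_mod]
      by (rule lin_ext_cong_S[OF phi(1)[OF g]]) (rule psi)
    also have "\<dots> = lin_ext (*) (\<theta> p) (diff F (Suc p) g)"
      by (simp add: phi(3)[OF g] SA.lin_ext_ext[unfolded act_S_mod] \<theta>_def[abs_def])
    finally show "lin_ext (*) (diff F (Suc p)) (\<theta> (Suc p) g) = lin_ext (*) (\<theta> p) (diff F (Suc p) g)" .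
  qed
  from F.homotopy_exists[OF this] obtain h where
    h: "\<And>p g. g \<in> gens F p \<Longrightarrow> h p g \<in> chains_deg (S_mod d m) F (Suc p) (gdeg F p g)"
      "\<And>g. g \<in> gens F 0 \<Longrightarrow> lin_ext (*) (diff F (Suc 0)) (h 0 g) = single g 1 - \<theta> 0 g"
      "\<And>p g. g \<in> gens F (Suc p) \<Longrightarrow> lin_ext (*) (diff F (Suc (Suc p))) (h (Suc p) g)
        = single g 1 - \<theta> (Suc p) g - lin_ext (*) (h p) (diff F (Suc p) g)"
    by blast
  show ?thesis
    unfolding acyclic_deg_def
  proof (intro allI ballI impI)
    fix p z assume z: "z \<in> chains_deg Y F p b" and bz: "bd Y F p z = 0"
    have hz: "lin_ext (act Y) (diff F (Suc p)) (lin_ext (act Y) (h p) z) = z - lin_ext (act Y) (\<theta> p) z"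
    proof (cases p)
      case 0
      have "lin_ext (act Y) (diff F (Suc p)) (lin_ext (act Y) (h p) z)
          = lin_ext (act Y) (\<lambda>g. single g 1 - \<theta> 0 g) z"
        unfolding lin_ext_ext using 0 z h(2) by (intro lin_ext_cong_chain[of z F p b]) auto
      with 0 show ?thesis by (simp add: lin_ext_diff_left)
    next
      case (Suc q)
      have "lin_ext (act Y) (diff F (Suc p)) (lin_ext (act Y) (h p) z)
          = lin_ext (act Y) (\<lambda>g. single g 1 - \<theta> p g - lin_ext (*) (h q) (diff F p g)) z"
        unfolding lin_ext_ext using Suc z h(3) by (intro lin_ext_cong_chain[of z F p b]) auto
      also have "\<dots> = z - lin_ext (act Y) (\<theta> p) z - lin_ext (act Y) (h q) (lin_ext (act Y) (diff F p) z)"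
        by (simp add: lin_ext_diff_left lin_ext_ext)
      finally show ?thesis using bz Suc by (simp add: bd_Suc)
    qed
    define w where "w = lin_ext (act Y) (\<phi> p) z"
    have w: "w \<in> chains_deg Y G p b"
      unfolding w_def using z phi(1) by (rule lin_ext_chains_deg)
    have "bd Y G p w = 0"
    proof (cases p)
      case 0
      then show ?thesis by (simp add: bd_def)
    next
      case (Suc q)
      have "lin_ext (act Y) (diff G p) w = lin_ext (act Y) (\<phi> q) (lin_ext (act Y) (diff F p) z)"
        unfolding w_def lin_ext_ext using Suc z phi(3) by (intro lin_ext_cong_chain[of z F p b]) auto
      with bz Suc show ?thesis by (simp add: bd_Suc)
    qed
    with acyc w obtain y where y: "y \<in> chains_deg Y G (Suc p) b" "bd Y G (Suc p) y = w"
      unfolding acyclic_deg_def by blast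
    have "lin_ext (act Y) (diff F (Suc p)) (lin_ext (act Y) (\<psi> (Suc p)) y)
        = lin_ext (act Y) (\<psi> p) (lin_ext (act Y) (diff G (Suc p)) y)"
      unfolding lin_ext_ext using y(1) psi(3) by (intro lin_ext_cong_chain[of y G "Suc p" b]) auto
    also have "\<dots> = lin_ext (act Y) (\<theta> p) z"
      using y(2) by (simp add: bd_Suc w_def lin_ext_ext \<theta>_def[abs_def])
    finally have "bd Y F (Suc p) (lin_ext (act Y) (\<psi> (Suc p)) y + lin_ext (act Y) (h p) z) = z"
      using hz by (simp add: bd_Suc lin_ext_add)
    moreover have "lin_ext (act Y) (\<psi> (Suc p)) y + lin_ext (act Y) (h p) z \<in> chains_deg Y F (Suc p) b"
      using y(1) psi(1) z h(1) by (intro chains_deg_add lin_ext_chains_deg)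
    ultimately show "\<exists>y\<in>chains_deg Y F (Suc p) b. bd Y F (Suc p) y = z" by blast
  qed
qed

section \<open>The exponent vectors\<close>

lemma finite_Avecs: "finite (Avecs d m)"
proof -
  let ?f = "\<lambda>v::vec. map (lookup v) [0..<Suc m]"
  have le: "lookup v r \<le> int d" if "v \<in> Avecs d m" "r \<le> m" for v r
  proof -
    have "lookup v r \<le> (\<Sum>r\<le>m. lookup v r)"
      using that by (intro member_le_sum) (auto simp: Avecs_def)
    with that show ?thesis by (simp add: Avecs_def total_def)
  qed
  then have "?f ` Avecs d m \<subseteq> {xs. set xs \<subseteq> {0..int d} \<and> length xs = Suc m}"
    by (auto simp: Avecs_def)
  then have "finite (?f ` Avecs d m)"
    by (rule finite_subset) (rule finite_lists_length_eq, simp)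
  moreover have "inj_on ?f (Avecs d m)"
  proof (rule inj_onI)
    fix v w assume vw: "v \<in> Avecs d m" "w \<in> Avecs d m" "?f v = ?f w"
    show "v = w"
    proof (rule poly_mapping_eqI)
      fix r
      show "lookup v r = lookup w r"
      proof (cases "r \<le> m")
        case True
        with vw(3) show ?thesis by (simp del: upt_Suc)
      next
        case False
        with vw(1,2) have "r \<notin> keys v" "r \<notin> keys w" by (auto simp: Avecs_def zvecs_def)
        then show ?thesis by (simp add: in_keys_iff)
      qed
    qed
  qed
  ultimately show ?thesis by (rule finite_imageD)
qed

lemma bij_betw_avec: "bij_betw (avec d m) {1..nvars d m} (Avecs d m)"
proof -
  let ?L = "rev (sorted_list_of_set (Avecs d m))"
  have "bij_betw (\<lambda>i. ?L ! i) {..<length ?L} (set ?L)"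
    by (rule bij_betw_nth) auto
  then have 1: "bij_betw (\<lambda>i. ?L ! i) {..<nvars d m} (Avecs d m)"
    by (simp add: nvars_def finite_Avecs)
  have 2: "bij_betw (\<lambda>i. i - 1) {1..nvars d m} {..<nvars d m}"
    by (rule bij_betw_byWitness[where f' = Suc]) auto
  from bij_betw_trans[OF 2 1] show ?thesis
    by (simp add: o_def avec_def[abs_def])
qed

lemma avec_in_Avecs: "i \<in> {1..nvars d m} \<Longrightarrow> avec d m i \<in> Avecs d m"
  using bij_betw_avec[of d m] by (auto simp: bij_betw_def)

lemma zvecs_add: "v \<in> zvecs m \<Longrightarrow> w \<in> zvecs m \<Longrightarrow> v + w \<in> zvecs m"
  using keys_add[of v w] by (auto simp: zvecs_def)

lemma zero_zvecs [simp]: "0 \<in> zvecs m"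
  by (simp add: zvecs_def)

lemma zvecs_sum: "(\<And>i. i \<in> I \<Longrightarrow> f i \<in> zvecs m) \<Longrightarrow> sum f I \<in> zvecs m"
  by (induction I rule: infinite_finite_induct) (auto intro: zvecs_add)

section \<open>The Koszul complex\<close>

text \<open>An element of the Koszul complex with coefficients in a module is handled as a function
  on the subsets of \<open>{1..n}\<close>; the basis element of \<open>\<sigma>\<close> is numbered by \<open>set_encode \<sigma>\<close>.\<close>

definition X :: "nat \<Rightarrow> 'k::field pol" where
  "X i = single (single i 1) 1"

text \<open>For \<open>i \<notin> \<tau>\<close> this is the sign of the face \<open>\<tau>\<close>
  in the boundary of \<open>insert i \<tau>\<close>. It is a polynomial and not an integer so that
  it can act on any module over \<open>S\<close>.\<close>

definition eps :: "nat \<Rightarrow> nat set \<Rightarrow> 'k::field pol" where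
  "eps i \<tau> = (-1) ^ card {t \<in> \<tau>. t < i}"

lemma eps_cases: "(eps i \<tau> :: 'k::field pol) = 1 \<or> eps i \<tau> = -1"
  by (simp add: eps_def minus_one_power_iff)

lemma eps_sq [simp]: "eps i \<tau> * eps i \<tau> = 1" "eps i \<tau> * (eps i \<tau> * f) = f"
  by (auto simp: eps_def minus_one_power_iff)

lemma eps_insert:
  assumes "finite \<tau>" "t \<notin> \<tau>"
  shows "eps i (insert t \<tau>) = (if t < i then - eps i \<tau> else eps i \<tau>)"
proof -
  have "{s \<in> insert t \<tau>. s < i} = (if t < i then insert t {s \<in> \<tau>. s < i} else {s \<in> \<tau>. s < i})"
    by auto
  with assms show ?thesis by (simp add: eps_def)
qed

definition koszul :: "nat \<Rightarrow> nat \<Rightarrow> ('k::field, 'k) free_complex" where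
  "koszul d m = \<lparr>
     gens = (\<lambda>p. set_encode ` {\<sigma>. \<sigma> \<subseteq> {1..nvars d m} \<and> card \<sigma> = p}),
     gdeg = (\<lambda>p g. \<Sum>i\<in>set_decode g. avec d m i),
     diff = (\<lambda>p g. \<Sum>i\<in>set_decode g. single (set_encode (set_decode g - {i}))
        (eps i (set_decode g - {i}) * X i)),
     aug = (\<lambda>g. 1)\<rparr>"

lemma subset_atLeastAtMost_finite: "\<sigma> \<subseteq> {1..n::nat} \<Longrightarrow> finite \<sigma>"
  by (rule finite_subset) auto

lemma gens_koszul_iff: "finite \<sigma> \<Longrightarrow>
    set_encode \<sigma> \<in> gens (koszul d m) p \<longleftrightarrow> \<sigma> \<subseteq> {1..nvars d m} \<and> card \<sigma> = p"
proof -
  assume "finite \<sigma>"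
  then have "set_encode \<sigma> = set_encode \<rho> \<longleftrightarrow> \<sigma> = \<rho>" if "\<rho> \<subseteq> {1..nvars d m}" for \<rho>
    using set_encode_eq subset_atLeastAtMost_finite[OF that] by blast
  then show ?thesis by (auto simp: koszul_def)
qed

lemma poly_mapping_eq_set_encodeI:
  assumes "\<And>\<sigma>. finite \<sigma> \<Longrightarrow> lookup v (set_encode \<sigma>) = lookup w (set_encode \<sigma>)"
  shows "v = w"
  using assms by (intro poly_mapping_eqI) (metis finite_set_decode set_decode_inverse)

text \<open>The terms cancel in pairs. Concluding from \<open>s = - s\<close> would fail in
  characteristic 2, hence the induction on \<open>A\<close>.\<close>

lemma sum_antisym_zero:
  fixes f :: "'a \<Rightarrow> 'a \<Rightarrow> 'b::ab_group_add"
  assumes "finite A" "\<And>i t. i \<in> A \<Longrightarrow> t \<in> A \<Longrightarrow> i \<noteq> t \<Longrightarrow> f i t = - f t i"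
  shows "(\<Sum>i\<in>A. \<Sum>t\<in>A - {i}. f i t) = 0"
  using assms
proof (induction A rule: finite_induct)
  case (insert a A)
  have "(\<Sum>i\<in>A. \<Sum>t\<in>insert a A - {i}. f i t) = (\<Sum>i\<in>A. f i a + (\<Sum>t\<in>A - {i}. f i t))"
  proof (intro sum.cong refl)
    fix i assume "i \<in> A"
    with insert.hyps have "insert a A - {i} = insert a (A - {i})" by auto
    with insert.hyps show "(\<Sum>t\<in>insert a A - {i}. f i t) = f i a + (\<Sum>t\<in>A - {i}. f i t)"
      by simp
  qed
  also have "\<dots> = (\<Sum>i\<in>A. f i a)"
  proof -
    have "(\<Sum>i\<in>A. \<Sum>t\<in>A - {i}. f i t) = 0"
      by (rule insert.IH) (rule insert.prems, auto)
    then show ?thesis by (simp add: sum.distrib)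
  qed
  also have "\<dots> = (\<Sum>i\<in>A. - f a i)"
    using insert.hyps by (intro sum.cong refl insert.prems) auto
  finally show ?case
    using insert.hyps by (simp add: sum_negf)
qed simp

section \<open>The Koszul boundary on functions on subsets\<close>

context pol_module
begin

text \<open>The boundary is read off at the target: the value at \<open>\<tau>\<close> collects the
  contributions of all sets that have one element more.\<close>

definition kbd :: "nat \<Rightarrow> (nat set \<Rightarrow> 'y) \<Rightarrow> nat set \<Rightarrow> 'y" where
  "kbd n w \<tau> = (\<Sum>i\<in>{1..n} - \<tau>. (eps i \<tau> * X i) *s w (insert i \<tau>))"

text \<open>Regroup the sum by the index \<open>i\<close> that is removed: the only generator whose
  boundary reaches \<open>\<tau>\<close> by removing \<open>i\<close> is that of
  \<open>insert i \<tau>\<close>.\<close>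

lemma lookup_koszul_bd:
  assumes w: "keys w \<subseteq> set_encode ` Pow {1..nvars d m}" and "finite \<tau>"
  shows "lookup (lin_ext scale (diff (koszul d m) p) w) (set_encode \<tau>)
    = kbd (nvars d m) (\<lambda>\<sigma>. lookup w (set_encode \<sigma>)) \<tau>"
proof -
  let ?n = "nvars d m"
  define G where "G = set_encode ` Pow {1..?n}"
  have fG: "finite G" by (simp add: G_def)
  have sub: "set_decode g \<subseteq> {1..?n}" if "g \<in> G" for g
  proof -
    from that obtain \<rho> where "\<rho> \<subseteq> {1..?n}" "g = set_encode \<rho>" by (auto simp: G_def)
    with subset_atLeastAtMost_finite[of \<rho>] show ?thesis by simp
  qed
  have coeff: "lookup (diff (koszul d m) p g) (set_encode \<tau>)
      = (\<Sum>i\<in>{1..?n}. if i \<notin> \<tau> \<and> g = set_encode (insert i \<tau>) then eps i \<tau> * X i else 0 :: 'k pol)"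
    if "g \<in> G" for g
  proof -
    have "lookup (diff (koszul d m) p g) (set_encode \<tau>)
        = (\<Sum>i\<in>set_decode g. if set_decode g - {i} = \<tau> then eps i \<tau> * X i else 0 :: 'k pol)"
      using \<open>finite \<tau>\<close> by (auto simp: koszul_def lookup_sum lookup_single when_def set_encode_eq intro!: sum.cong)
    also have "\<dots> = (\<Sum>i\<in>{1..?n}. if i \<notin> \<tau> \<and> g = set_encode (insert i \<tau>) then eps i \<tau> * X i else 0)"
    proof (rule sum.mono_neutral_cong_left)
      show "\<forall>i\<in>{1..?n} - set_decode g.
          (if i \<notin> \<tau> \<and> g = set_encode (insert i \<tau>) then eps i \<tau> * X i else 0 :: 'k pol) = 0"
        using \<open>finite \<tau>\<close> by (auto simp del: set_encode_insert)
      fix i assume i: "i \<in> set_decode g"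
      have "set_decode g - {i} = \<tau> \<longleftrightarrow> i \<notin> \<tau> \<and> set_decode g = insert i \<tau>"
        using i by auto
      also have "\<dots> \<longleftrightarrow> i \<notin> \<tau> \<and> g = set_encode (insert i \<tau>)"
        using \<open>finite \<tau>\<close> by (metis finite_insert set_decode_inverse set_encode_inverse)
      finally show "(if set_decode g - {i} = \<tau> then eps i \<tau> * X i else 0 :: 'k pol)
          = (if i \<notin> \<tau> \<and> g = set_encode (insert i \<tau>) then eps i \<tau> * X i else 0)" by simp
    qed (use sub[OF that] in auto)
    finally show ?thesis .
  qed
  have "lookup (lin_ext scale (diff (koszul d m) p) w) (set_encode \<tau>)
      = (\<Sum>g\<in>G. \<Sum>i\<in>{1..?n}. if i \<notin> \<tau> \<and> g = set_encode (insert i \<tau>)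
          then (eps i \<tau> * X i) *s lookup w g else 0)"
    by (subst lookup_ext[OF fG w[folded G_def]])
      (auto simp: coeff scale_sum_left simp del: set_encode_insert intro!: sum.cong)
  also have "\<dots> = (\<Sum>i\<in>{1..?n}. \<Sum>g\<in>G. if i \<notin> \<tau> \<and> g = set_encode (insert i \<tau>)
          then (eps i \<tau> * X i) *s lookup w g else 0)"
    by (rule sum.swap)
  also have "\<dots> = (\<Sum>i\<in>{1..?n} - \<tau>. (eps i \<tau> * X i) *s lookup w (set_encode (insert i \<tau>)))"
  proof (rule sum.mono_neutral_cong_right)
    fix i assume i: "i \<in> {1..?n} - \<tau>"
    have "(\<Sum>g\<in>G. if i \<notin> \<tau> \<and> g = set_encode (insert i \<tau>) then (eps i \<tau> * X i) *s lookup w g else 0)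
        = (\<Sum>g\<in>G. if g = set_encode (insert i \<tau>) then (eps i \<tau> * X i) *s lookup w g else 0)"
      using i by (simp del: set_encode_insert)
    also have "\<dots> = (eps i \<tau> * X i) *s lookup w (set_encode (insert i \<tau>))"
    proof -
      have "lookup w h = 0" if "h \<notin> G" for h
        using w that by (auto simp: G_def in_keys_iff)
      with fG show ?thesis by (auto simp del: set_encode_insert)
    qed
    finally show "(\<Sum>g\<in>G. if i \<notin> \<tau> \<and> g = set_encode (insert i \<tau>) then (eps i \<tau> * X i) *s lookup w g else 0)
        = (eps i \<tau> * X i) *s lookup w (set_encode (insert i \<tau>))" .
  qed auto
  finally show ?thesis by (simp add: kbd_def)
qed

lemma kbd_cong: "(\<And>i. i \<in> {1..n} - \<tau> \<Longrightarrow> v (insert i \<tau>) = w (insert i \<tau>)) \<Longrightarrow> kbd n v \<tau> = kbd n w \<tau>"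
  by (simp add: kbd_def)

text \<open>Exchanging \<open>i\<close> and \<open>t\<close> flips the product of the signs:
  inserting the smaller index changes the sign belonging to the larger one, but not conversely. The
  variables commute.\<close>

lemma kbd_kbd:
  assumes "finite \<tau>"
  shows "kbd n (kbd n w) \<tau> = 0"
proof -
  let ?A = "{1..n} - \<tau>"
  have "kbd n (kbd n w) \<tau> = (\<Sum>i\<in>?A. \<Sum>t\<in>?A - {i}.
      ((eps i \<tau> * eps t (insert i \<tau>)) * (X i * X t)) *s w (insert t (insert i \<tau>)))"
    unfolding kbd_def scale_sum_right
    by (intro sum.cong refl) (auto simp: mult_ac)
  also have "\<dots> = 0"
    using assms by (intro sum_antisym_zero) (auto simp: eps_insert insert_commute mult_ac)
  finally show ?thesis .
qed

end

section \<open>Contraction along one variable\<close>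

locale koszul_contraction = pol_module scale
  for scale :: "'k::field pol \<Rightarrow> 'y::ab_group_add \<Rightarrow> 'y" (infixr \<open>*s\<close> 75) +
  fixes n v :: nat and D :: "'y \<Rightarrow> 'y"
  assumes v: "v \<in> {1..n}"
    and D_add: "D (x + y) = D x + D y"
    and D_scale: "i \<noteq> v \<Longrightarrow> D (X i *s y) = X i *s D y"
    and D_cancel: "D (X v *s y) = y"
begin

lemma D_zero [simp]: "D 0 = 0"
  using D_add[of 0 0] by simp

lemma D_uminus: "D (- x) = - D x"
  using D_add[of x "- x"] by (simp add: eq_neg_iff_add_eq_0 add.commute)

lemma D_sum: "D (sum f I) = (\<Sum>i\<in>I. D (f i))"
  by (induction I rule: infinite_finite_induct) (simp_all add: D_add)

lemma D_eps: "D (eps i \<tau> *s y) = eps i \<tau> *s D y"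
proof -
  have "eps i \<tau> = (1 :: 'k pol) \<or> eps i \<tau> = (-1 :: 'k pol)" by (rule eps_cases)
  then show ?thesis
  proof
    assume *: "eps i \<tau> = (-1 :: 'k pol)"
    show ?thesis unfolding * by (simp add: D_uminus)
  qed simp
qed

definition hom :: "(nat set \<Rightarrow> 'y) \<Rightarrow> nat set \<Rightarrow> 'y" where
  "hom w \<sigma> = (if v \<in> \<sigma> then eps v (\<sigma> - {v}) *s D (w (\<sigma> - {v})) else 0)"

text \<open>If \<open>v \<notin> \<tau>\<close>, the second summand is 0 and in the first only the
  term \<open>i = v\<close> reaches a set containing \<open>v\<close>. If
  \<open>v \<in> \<tau>\<close>, the terms with \<open>i \<noteq> v\<close> cancel, because
  \<open>v\<close> and \<open>i\<close> are inserted in opposite orders; the term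
  \<open>i = v\<close> remains, where \<open>D\<close> undoes \<open>X v\<close>.\<close>

lemma homotopy:
  assumes "finite \<tau>"
  shows "kbd n (hom w) \<tau> + hom (kbd n w) \<tau> = (if v \<in> \<tau> then w \<tau> else X v *s D (w \<tau>))"
proof (cases "v \<in> \<tau>")
  case False
  have "kbd n (hom w) \<tau> = (\<Sum>i\<in>{1..n} - \<tau>. if i = v then X v *s D (w \<tau>) else 0)"
    unfolding kbd_def
  proof (intro sum.cong refl)
    fix i assume "i \<in> {1..n} - \<tau>"
    with False show "(eps i \<tau> * X i) *s hom w (insert i \<tau>) = (if i = v then X v *s D (w \<tau>) else 0)"
      by (auto simp: hom_def mult_ac)
  qed
  also have "\<dots> = X v *s D (w \<tau>)"
    using v False by simp
  finally show ?thesis using False by (simp add: hom_def)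
next
  case True
  define \<rho> where "\<rho> = \<tau> - {v}"
  have \<rho>: "finite \<rho>" "v \<notin> \<rho>" "\<tau> = insert v \<rho>" using True assms by (auto simp: \<rho>_def)
  have "kbd n (hom w) \<tau> = (\<Sum>i\<in>{1..n} - \<tau>. - (eps v \<rho> * (eps i \<rho> * X i)) *s D (w (insert i \<rho>)))"
    unfolding kbd_def
  proof (intro sum.cong refl)
    fix i assume i: "i \<in> {1..n} - \<tau>"
    then have "insert i \<tau> - {v} = insert i \<rho>" "i \<noteq> v" "i \<notin> \<rho>" using \<rho> by auto
    with \<rho> show "(eps i \<tau> * X i) *s hom w (insert i \<tau>)
        = - (eps v \<rho> * (eps i \<rho> * X i)) *s D (w (insert i \<rho>))"
      by (auto simp: hom_def eps_insert mult_ac)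
  qed
  moreover have "hom (kbd n w) \<tau> = eps v \<rho> *s (\<Sum>i\<in>{1..n} - \<rho>. D ((eps i \<rho> * X i) *s w (insert i \<rho>)))"
    using True by (simp add: hom_def kbd_def D_sum \<rho>_def[symmetric])
  moreover have "{1..n} - \<rho> = insert v ({1..n} - \<tau>)" using v \<rho> by auto
  moreover have "D ((eps i \<rho> * X i) *s w (insert i \<rho>)) = (eps i \<rho> * X i) *s D (w (insert i \<rho>))"
    if "i \<in> {1..n} - \<tau>" for i
  proof -
    from that True have "i \<noteq> v" by auto
    then show ?thesis
      by (simp add: scale_scale[symmetric] D_eps D_scale del: scale_scale)
  qed
  moreover have "D ((eps v \<rho> * X v) *s w (insert v \<rho>)) = eps v \<rho> *s w \<tau>"
    using \<rho>(3) by (simp add: scale_scale[symmetric] D_eps D_cancel del: scale_scale)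
  ultimately show ?thesis
    using True by (simp add: scale_right_distrib scale_sum_right sum_negf)
qed

end

section \<open>Koszul chains and functions on subsets\<close>

definition of_fun :: "nat \<Rightarrow> nat \<Rightarrow> (nat set \<Rightarrow> 'y) \<Rightarrow> (nat \<Rightarrow>\<^sub>0 'y::ab_group_add)" where
  "of_fun n p W = (\<Sum>\<sigma>\<in>{\<sigma>. \<sigma> \<subseteq> {1..n} \<and> card \<sigma> = p}. single (set_encode \<sigma>) (W \<sigma>))"

lemma lookup_of_fun:
  assumes "finite \<sigma>"
  shows "lookup (of_fun n p W) (set_encode \<sigma>) = (if \<sigma> \<subseteq> {1..n} \<and> card \<sigma> = p then W \<sigma> else 0)"
proof -
  have "lookup (of_fun n p W) (set_encode \<sigma>)
      = (\<Sum>\<rho>\<in>{\<sigma>. \<sigma> \<subseteq> {1..n} \<and> card \<sigma> = p}. if \<rho> = \<sigma> then W \<rho> else 0)"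
    unfolding of_fun_def lookup_sum
  proof (intro sum.cong refl)
    fix \<rho> assume "\<rho> \<in> {\<sigma>. \<sigma> \<subseteq> {1..n} \<and> card \<sigma> = p}"
    then have "finite \<rho>" using subset_atLeastAtMost_finite by blast
    with assms show "lookup (single (set_encode \<rho>) (W \<rho>)) (set_encode \<sigma>) = (if \<rho> = \<sigma> then W \<rho> else 0)"
      by (auto simp: lookup_single when_def set_encode_eq)
  qed
  also have "finite {\<sigma>. \<sigma> \<subseteq> {1..n} \<and> card \<sigma> = p}" by simp
  then have "(\<Sum>\<rho>\<in>{\<sigma>. \<sigma> \<subseteq> {1..n} \<and> card \<sigma> = p}. if \<rho> = \<sigma> then W \<rho> else 0)
      = (if \<sigma> \<subseteq> {1..n} \<and> card \<sigma> = p then W \<sigma> else 0)"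
    by simp
  finally show ?thesis .
qed

lemma keys_of_fun: "keys (of_fun (nvars d m) p W) \<subseteq> gens (koszul d m) p"
proof
  fix g assume "g \<in> keys (of_fun (nvars d m) p W)"
  then have "lookup (of_fun (nvars d m) p W) (set_encode (set_decode g)) \<noteq> 0"
    by (simp add: in_keys_iff)
  then have "set_encode (set_decode g) \<in> gens (koszul d m) p"
    by (subst gens_koszul_iff) (auto simp: lookup_of_fun simp del: set_decode_inverse split: if_splits)
  then show "g \<in> gens (koszul d m) p" by simp
qed

lemma gens_koszul_subset: "gens (koszul d m) p \<subseteq> set_encode ` Pow {1..nvars d m}"
  by (auto simp: koszul_def)

lemma lookup_set_encode_zero:
  "keys w \<subseteq> gens (koszul d m) p \<Longrightarrow> finite \<sigma> \<Longrightarrow> \<not> (\<sigma> \<subseteq> {1..nvars d m} \<and> card \<sigma> = p)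
    \<Longrightarrow> lookup w (set_encode \<sigma>) = 0"
  using gens_koszul_iff[of \<sigma> d m p] by (auto simp: in_keys_iff)

text \<open>Cutting down to sets of size \<open>Suc p\<close> loses nothing: \<open>hom\<close>
  inserts \<open>v\<close>, so it vanishes at \<open>\<sigma>\<close> unless \<open>w\<close> is
  supported at \<open>\<sigma> - {v}\<close>, a set of size \<open>p\<close>.\<close>

lemma (in koszul_contraction) lookup_of_fun_hom:
  assumes "n = nvars d m" "keys w \<subseteq> gens (koszul d m) p" "finite \<sigma>"
  shows "lookup (of_fun n (Suc p) (hom (\<lambda>\<sigma>. lookup w (set_encode \<sigma>)))) (set_encode \<sigma>)
    = hom (\<lambda>\<sigma>. lookup w (set_encode \<sigma>)) \<sigma>"
proof (cases "\<sigma> \<subseteq> {1..n} \<and> card \<sigma> = Suc p")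
  case False
  have "hom (\<lambda>\<sigma>. lookup w (set_encode \<sigma>)) \<sigma> = 0"
  proof (cases "v \<in> \<sigma>")
    case True
    with False v assms(3) have "\<not> (\<sigma> - {v} \<subseteq> {1..nvars d m} \<and> card (\<sigma> - {v}) = p)"
      unfolding assms(1) by (metis (no_types, lifting) Suc_diff_1 card_Diff_singleton card_gt_0_iff empty_iff
          insert_Diff insert_subset)
    then have "lookup w (set_encode (\<sigma> - {v})) = 0"
      using assms(3) by (intro lookup_set_encode_zero[OF assms(2)]) auto
    then show ?thesis by (simp add: hom_def)
  qed (simp add: hom_def)
  with False assms(3) show ?thesis by (simp add: lookup_of_fun)
qed (use assms(3) in \<open>simp add: lookup_of_fun\<close>)

text \<open>On a cycle the second summand of \<open>homotopy\<close> vanishes. For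
  \<open>p = 0\<close> this needs no assumption on the boundary, since \<open>kbd\<close> evaluates
  \<open>w\<close> at non-empty sets only.\<close>

lemma (in koszul_contraction) lookup_bd_of_fun_hom:
  assumes n: "n = nvars d m" and w: "keys w \<subseteq> gens (koszul d m) p" and "finite \<tau>"
    and cycle: "p = 0 \<or> lin_ext scale (diff (koszul d m) p) w = 0"
  shows "lookup (lin_ext scale (diff (koszul d m) (Suc p))
      (of_fun n (Suc p) (hom (\<lambda>\<sigma>. lookup w (set_encode \<sigma>))))) (set_encode \<tau>)
    = (if v \<in> \<tau> then lookup w (set_encode \<tau>) else X v *s D (lookup w (set_encode \<tau>)))"
proof -
  let ?w = "\<lambda>\<sigma>. lookup w (set_encode \<sigma>)"
  have wP: "keys w \<subseteq> set_encode ` Pow {1..nvars d m}"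
    using w gens_koszul_subset by blast
  have kbd0: "kbd n ?w \<rho> = 0" if "finite \<rho>" for \<rho>
    using cycle
  proof
    assume "p = 0"
    have "?w (insert i \<rho>) = 0" if "i \<notin> \<rho>" for i
    proof (rule lookup_set_encode_zero[OF w])
      have "card (insert i \<rho>) \<noteq> p" using that \<open>finite \<rho>\<close> \<open>p = 0\<close> by simp
      then show "\<not> (insert i \<rho> \<subseteq> {1..nvars d m} \<and> card (insert i \<rho>) = p)" by blast
    qed (use \<open>finite \<rho>\<close> in simp)
    then show ?thesis by (simp add: kbd_def)
  next
    assume "lin_ext scale (diff (koszul d m) p) w = 0"
    with lookup_koszul_bd[OF wP that, of p] show ?thesis by (simp add: n)
  qed
  have "lookup (lin_ext scale (diff (koszul d m) (Suc p)) (of_fun n (Suc p) (hom ?w))) (set_encode \<tau>)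
      = kbd n (\<lambda>\<sigma>. lookup (of_fun n (Suc p) (hom ?w)) (set_encode \<sigma>)) \<tau>"
    unfolding n using keys_of_fun gens_koszul_subset \<open>finite \<tau>\<close>
    by (intro lookup_koszul_bd) blast
  also have "\<dots> = kbd n (hom ?w) \<tau>"
    using \<open>finite \<tau>\<close> by (intro kbd_cong lookup_of_fun_hom[OF n w]) simp
  also have "\<dots> = kbd n (hom ?w) \<tau> + hom (kbd n ?w) \<tau>"
    using kbd0 \<open>finite \<tau>\<close> by (simp add: hom_def)
  also have "\<dots> = (if v \<in> \<tau> then ?w \<tau> else X v *s D (?w \<tau>))"
    by (rule homotopy) fact
  finally show ?thesis .
qed

section \<open>The Koszul complex is a graded complex over \<open>k\<close>\<close>

lemma gens_koszulE:
  assumes "g \<in> gens (koszul d m) p"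
  obtains \<sigma> where "g = set_encode \<sigma>" "\<sigma> \<subseteq> {1..nvars d m}" "card \<sigma> = p" "finite \<sigma>"
  using assms subset_atLeastAtMost_finite by (auto simp: koszul_def)

lemma koszul_simps [simp]:
  "gdeg (koszul d m) p g = (\<Sum>i\<in>set_decode g. avec d m i)"
  "aug (koszul d m) g = 1"
  by (simp_all add: koszul_def)

lemma X_homS: "i \<in> {1..nvars d m} \<Longrightarrow> X i \<in> homS d m (avec d m i)"
  by (simp add: X_def homS_iff polyS_def flip: One_nat_def)

lemma homS_uminus: "f \<in> homS d m b \<Longrightarrow> - f \<in> homS d m b"
  by (simp add: homS_iff polyS_uminus)

lemma eps_X_homS: "i \<in> {1..nvars d m} \<Longrightarrow> eps j \<tau> * X i \<in> homS d m (avec d m i)"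
  by (simp add: eps_def minus_one_power_iff X_homS homS_uminus)

lemma koszul_diff_deg:
  assumes "g \<in> gens (koszul d m) (Suc p)"
  shows "diff (koszul d m) (Suc p) g
    \<in> chains_deg (S_mod d m) (koszul d m :: ('k::field, 'k) free_complex) p (gdeg (koszul d m) (Suc p) g)"
proof -
  let ?K = "koszul d m :: ('k, 'k) free_complex"
  obtain \<sigma> where \<sigma>: "g = set_encode \<sigma>" "\<sigma> \<subseteq> {1..nvars d m}" "card \<sigma> = Suc p" "finite \<sigma>"
    using assms by (rule gens_koszulE)
  have "single (set_encode (\<sigma> - {i})) (eps i (\<sigma> - {i}) * X i :: 'k pol)
      \<in> chains_deg (S_mod d m) ?K p (\<Sum>i\<in>\<sigma>. avec d m i)" if i: "i \<in> \<sigma>" for i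
  proof -
    have "set_encode (\<sigma> - {i}) \<in> gens ?K p"
      using \<sigma> i by (subst gens_koszul_iff) auto
    moreover have "(\<Sum>i\<in>\<sigma>. avec d m i) - (\<Sum>i\<in>\<sigma> - {i}. avec d m i) = avec d m i"
      using \<sigma>(4) i by (simp add: sum.remove)
    ultimately show ?thesis
      using eps_X_homS[of i d m i "\<sigma> - {i}"] \<sigma> i
      by (auto simp: chains_deg_def lookup_single when_def SA.comp_zero)
  qed
  then have "(\<Sum>i\<in>\<sigma>. single (set_encode (\<sigma> - {i})) (eps i (\<sigma> - {i}) * X i :: 'k pol))
      \<in> chains_deg (S_mod d m) ?K p (\<Sum>i\<in>\<sigma>. avec d m i)"
    by (rule SA.chains_deg_sum)
  moreover have "diff ?K (Suc p) g = (\<Sum>i\<in>\<sigma>. single (set_encode (\<sigma> - {i})) (eps i (\<sigma> - {i}) * X i))"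
    using \<sigma> by (simp add: koszul_def)
  ultimately show ?thesis using \<sigma> by simp
qed

lemma koszul_bd_chains:
  "w \<in> chains (S_mod d m) (koszul d m :: ('k::field, 'k) free_complex) (Suc p) \<Longrightarrow>
    lin_ext (*) (diff (koszul d m :: ('k::field, 'k) free_complex) (Suc p)) w \<in> chains (S_mod d m) (koszul d m :: ('k::field, 'k) free_complex) p"
  using koszul_diff_deg chains_deg_subset_chains by (blast intro: lin_ext_chains)

lemma chains_keys: "w \<in> chains Y F p \<Longrightarrow> keys w \<subseteq> gens F p"
  by (simp add: chains_def)

lemma koszul_bd_bd:
  assumes w: "w \<in> chains (S_mod d m) (koszul d m :: ('k::field, 'k) free_complex) (Suc p)" 
  shows "lin_ext (*) (diff (koszul d m :: ('k, 'k) free_complex) p) (lin_ext (*) (diff (koszul d m) (Suc p)) w) = 0"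
proof (rule poly_mapping_eq_set_encodeI)
  fix \<tau> :: "nat set" assume \<tau>: "finite \<tau>"
  let ?v = "lin_ext (*) (diff (koszul d m :: ('k, 'k) free_complex) (Suc p)) w"
  note lk = SA.lookup_koszul_bd[unfolded act_S_mod]
  have w': "keys w \<subseteq> set_encode ` Pow {1..nvars d m}"
    using chains_keys[OF w] gens_koszul_subset by blast
  have v: "keys ?v \<subseteq> set_encode ` Pow {1..nvars d m}"
    using chains_keys[OF koszul_bd_chains[OF w]] gens_koszul_subset by blast
  have "lookup (lin_ext (*) (diff (koszul d m :: ('k, 'k) free_complex) p) ?v) (set_encode \<tau>)
      = pol_module.kbd (*) (nvars d m) (\<lambda>\<sigma>. lookup ?v (set_encode \<sigma>)) \<tau>"
    by (rule lk[OF v \<tau>])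
  also have "\<dots> = pol_module.kbd (*) (nvars d m)
      (pol_module.kbd (*) (nvars d m) (\<lambda>\<sigma>. lookup w (set_encode \<sigma>))) \<tau>"
    using \<tau> by (intro SA.kbd_cong[unfolded act_S_mod] lk[OF w']) simp
  also have "\<dots> = 0"
    using \<tau> by (rule SA.kbd_kbd[unfolded act_S_mod])
  finally show "lookup (lin_ext (*) (diff (koszul d m :: ('k, 'k) free_complex) p) ?v) (set_encode \<tau>)
      = lookup 0 (set_encode \<tau>)" by simp
qed

lemma aug_map_koszul:
  "w \<in> chains (S_mod d m) (koszul d m :: ('k::field, 'k) free_complex) 0 \<Longrightarrow>
    aug_map k_mod (koszul d m :: ('k::field, 'k) free_complex) w = lookup (lookup w 0) 0"
proof -
  assume w: "w \<in> chains (S_mod d m) (koszul d m :: ('k, 'k) free_complex) 0"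
  have "gens (koszul d m :: ('k, 'k) free_complex) 0 \<subseteq> {0}"
    by (auto elim!: gens_koszulE)
  with chains_keys[OF w] have "keys w \<subseteq> {0}" by blast
  then show ?thesis by (simp add: aug_map_k[of "{0}"])
qed

text \<open>The coefficient of a boundary at the empty set is a combination of variables and hence
  has no constant term.\<close>

lemma koszul_aug_bd:
  assumes w: "w \<in> chains (S_mod d m) (koszul d m :: ('k::field, 'k) free_complex) (Suc 0)"
  shows "aug_map k_mod (koszul d m :: ('k, 'k) free_complex) (lin_ext (*) (diff (koszul d m) (Suc 0)) w) = 0"
proof -
  let ?v = "lin_ext (*) (diff (koszul d m :: ('k, 'k) free_complex) (Suc 0)) w"
  have w': "keys w \<subseteq> set_encode ` Pow {1..nvars d m}"
    using chains_keys[OF w] gens_koszul_subset by blast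
  have X0: "lookup (X i :: 'k pol) 0 = 0" for i
    by (simp add: X_def lookup_single when_def poly_mapping_eq_iff fun_eq_iff)
  have "lookup ?v (set_encode {}) = pol_module.kbd (*) (nvars d m) (\<lambda>\<sigma>. lookup w (set_encode \<sigma>)) {}"
    by (rule SA.lookup_koszul_bd[unfolded act_S_mod, OF w']) simp
  then have "lookup (lookup ?v 0) 0 = 0"
    by (simp add: SA.kbd_def[unfolded act_S_mod] lookup_sum lookup_mult_zero X0)
  then show ?thesis by (simp add: aug_map_koszul koszul_bd_chains[OF w])
qed

section \<open>Exactness of the Koszul complex over \<open>S\<close>\<close>

definition divX :: "nat \<Rightarrow> 'k::field pol \<Rightarrow> 'k pol" where
  "divX v f = Poly_Mapping.map_key (\<lambda>u. u + single v 1) f"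

lemma lookup_divX: "lookup (divX v f) u = lookup f (u + single v 1)"
  by (simp add: divX_def map_key.rep_eq inj_def)

lemma lookup_X_mult:
  "lookup (X v * f) u = (if lookup u v = 0 then 0 else lookup f (u - single v 1))"
proof -
  have eq: "u = single v 1 + q \<longleftrightarrow> lookup u v \<noteq> 0 \<and> u - single v 1 = q" for q :: "nat \<Rightarrow>\<^sub>0 nat"
    by (auto simp: poly_mapping_eq_iff fun_eq_iff lookup_add lookup_minus lookup_single when_def)
  have "lookup (X v * f) u = (\<Sum>l. (\<Sum>q. lookup f q when u = l + q) when single v 1 = l)"
    by (simp add: X_def lookup_mult lookup_single when_mult)
  also have "\<dots> = (\<Sum>q. lookup f q when u = single v 1 + q)"
    by (rule Sum_any_when_equal')
  also have "\<dots> = (if lookup u v = 0 then 0 else lookup f (u - single v 1))"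
    unfolding eq by simp
  finally show ?thesis .
qed

lemma koszul_contraction_divX:
  assumes "v \<in> {1..n}"
  shows "koszul_contraction (*) n v (divX v :: 'k::field pol \<Rightarrow> 'k pol)"
proof (intro koszul_contraction.intro koszul_contraction_axioms.intro pol_module.intro module_times)
  fix f g :: "'k pol" and i
  show "divX v (f + g) = divX v f + divX v g"
    by (rule poly_mapping_eqI) (simp add: lookup_divX lookup_add)
  show "divX v (X v * f) = f"
    by (rule poly_mapping_eqI) (simp add: lookup_divX lookup_X_mult lookup_add)
  show "divX v (X i * f) = X i * divX v f" if "i \<noteq> v"
  proof (rule poly_mapping_eqI)
    fix u :: "nat \<Rightarrow>\<^sub>0 nat"
    have "u + single v 1 - single i 1 = u - single i 1 + single v 1" if "lookup u i \<noteq> 0"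
      using that by (auto simp: poly_mapping_eq_iff fun_eq_iff lookup_add lookup_minus lookup_single when_def)
    with that show "lookup (divX v (X i * f)) u = lookup (X i * divX v f) u"
      by (simp add: lookup_divX lookup_X_mult lookup_add lookup_single when_def)
  qed
qed fact

lemma lookup_diff_X_divX: "lookup (f - X v * divX v f) u = (if lookup u v = 0 then lookup f u else 0)"
proof -
  have "u - single v 1 + single v 1 = u" if "lookup u v \<noteq> 0"
    using that by (auto simp: poly_mapping_eq_iff fun_eq_iff lookup_add lookup_minus lookup_single when_def)
  then show ?thesis by (simp add: lookup_minus lookup_X_mult lookup_divX)
qed

lemma divX_polyS: "f \<in> polyS d m \<Longrightarrow> divX v f \<in> polyS d m"
proof -
  assume f: "f \<in> polyS d m"
  have "keys u \<subseteq> {1..nvars d m}" if "u \<in> keys (divX v f)" for u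
  proof -
    have "u + single v 1 \<in> keys f" using that by (simp add: in_keys_iff lookup_divX)
    with f have "keys (u + single v 1) \<subseteq> {1..nvars d m}" by (auto simp: polyS_def)
    then show ?thesis by (simp add: keys_nat_add)
  qed
  then show ?thesis by (simp add: polyS_def)
qed

lemma eps_mult_polyS: "f \<in> polyS d m \<Longrightarrow> eps i \<tau> * f \<in> polyS d m"
  by (simp add: eps_def minus_one_power_iff polyS_uminus)

text \<open>Contracting with respect to one variable after the other moves a cycle within its homology
  class until it involves no variable at all.\<close>

lemma koszul_exact:
  fixes d m :: nat
  defines "K \<equiv> koszul d m :: ('k::field, 'k) free_complex"
  assumes w: "w \<in> chains (S_mod d m) K p"
    and cycle: "if p = 0 then aug_map k_mod K w = 0 else lin_ext (*) (diff K p) w = 0"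
  shows "\<exists>y\<in>chains (S_mod d m) K (Suc p). lin_ext (*) (diff K (Suc p)) y = w"
proof -
  note e = SA.lin_ext_diff[unfolded act_S_mod] SA.lin_ext_add[unfolded act_S_mod]
    SA.lin_ext_zero[unfolded act_S_mod]
  define n where "n = nvars d m"
  \<comment> \<open>Neither the index sets supporting \<open>w\<close> nor the monomials of its
    coefficients involve one of the first \<open>i\<close> variables.\<close>
  define good where "good i w \<longleftrightarrow>
      (\<forall>\<tau>. finite \<tau> \<longrightarrow> (\<forall>u\<in>keys (lookup w (set_encode \<tau>)). (\<tau> \<union> keys u) \<inter> {1..i} = {}))"
    for i and w :: "nat \<Rightarrow>\<^sub>0 'k pol"
  have bd_chains: "lin_ext (*) (diff K (Suc p)) y \<in> chains (S_mod d m) K p"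
    if "y \<in> chains (S_mod d m) K (Suc p)" for y
    using that unfolding K_def by (rule koszul_bd_chains)
  have chains_sub: "u - v \<in> chains (S_mod d m) K p"
    if "u \<in> chains (S_mod d m) K p" "v \<in> chains (S_mod d m) K p" for u v
  proof -
    have "a - b \<in> polyS d m" if "a \<in> polyS d m" "b \<in> polyS d m" for a b :: "'k pol"
      using polyS_add[OF that(1) polyS_uminus[OF that(2)]] by simp
    with that keys_diff_sub[of u v] show ?thesis by (auto simp: chains_def lookup_minus)
  qed
  have "\<exists>y\<in>chains (S_mod d m) K (Suc p). good i (w - lin_ext (*) (diff K (Suc p)) y)" if "i \<le> n" for i
    using that
  proof (induction i)
    case 0
    have "good 0 (w - lin_ext (*) (diff K (Suc p)) 0)" by (simp add: good_def)
    moreover have "0 \<in> chains (S_mod d m) K (Suc p)" by (simp add: chains_def)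
    ultimately show ?case by blast
  next
    case (Suc i)
    then obtain y where y: "y \<in> chains (S_mod d m) K (Suc p)"
      and g: "good i (w - lin_ext (*) (diff K (Suc p)) y)" by auto
    define w1 where "w1 = w - lin_ext (*) (diff K (Suc p)) y"
    have w1: "w1 \<in> chains (S_mod d m) K p"
      unfolding w1_def using w bd_chains[OF y] by (rule chains_sub)
    have cycle1: "p = 0 \<or> lin_ext (*) (diff K p) w1 = 0"
      using cycle koszul_bd_bd[of y d m p] y by (auto simp: w1_def e K_def split: if_splits)
    interpret C: koszul_contraction "(*)" n "Suc i" "divX (Suc i) :: 'k pol \<Rightarrow> 'k pol"
      using Suc.prems by (intro koszul_contraction_divX) simp
    define z where "z = of_fun n (Suc p) (C.hom (\<lambda>\<sigma>. lookup w1 (set_encode \<sigma>)))"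
    have "C.hom (\<lambda>\<sigma>. lookup w1 (set_encode \<sigma>)) \<sigma> \<in> polyS d m" for \<sigma>
      using chainsD[OF w1] by (auto simp: C.hom_def intro: eps_mult_polyS divX_polyS)
    then have z: "z \<in> chains (S_mod d m) K (Suc p)"
      using keys_of_fun[of d m "Suc p"] unfolding chains_def z_def K_def n_def
      by (auto elim!: gens_koszulE simp: lookup_of_fun)
    have lz: "lookup (lin_ext (*) (diff K (Suc p)) z) (set_encode \<tau>)
        = (if Suc i \<in> \<tau> then lookup w1 (set_encode \<tau>)
           else X (Suc i) * divX (Suc i) (lookup w1 (set_encode \<tau>)))" if "finite \<tau>" for \<tau>
      using C.lookup_bd_of_fun_hom[OF n_def chains_keys[OF w1[unfolded K_def]] that] cycle1
      unfolding z_def K_def by blast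
    \<comment> \<open>Subtracting the boundary of \<open>z\<close> removes all entries at sets
      containing \<open>Suc i\<close>, and at the other sets all monomials divisible by that
      variable. No new monomials arise, so what was achieved for the earlier variables
      persists.\<close>
    have "good (Suc i) (w1 - lin_ext (*) (diff K (Suc p)) z)"
      unfolding good_def
    proof (intro allI impI ballI)
      fix \<tau> :: "nat set" and u
      assume \<tau>: "finite \<tau>" and u: "u \<in> keys (lookup (w1 - lin_ext (*) (diff K (Suc p)) z) (set_encode \<tau>))"
      have "Suc i \<notin> \<tau> \<and> lookup u (Suc i) = 0 \<and> u \<in> keys (lookup w1 (set_encode \<tau>))"
        using u lz[OF \<tau>] lookup_diff_X_divX[of "lookup w1 (set_encode \<tau>)" "Suc i" u]
        by (auto simp: in_keys_iff lookup_minus[of w1] split: if_splits)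
      moreover from this g \<tau> have "(\<tau> \<union> keys u) \<inter> {1..i} = {}"
        by (auto simp: good_def w1_def)
      ultimately show "(\<tau> \<union> keys u) \<inter> {1..Suc i} = {}"
        by (auto simp: atLeastAtMostSuc_conv in_keys_iff)
    qed
    moreover have "w1 - lin_ext (*) (diff K (Suc p)) z = w - lin_ext (*) (diff K (Suc p)) (y + z)"
      by (simp add: w1_def e)
    moreover have "y + z \<in> chains (S_mod d m) K (Suc p)"
      using y z keys_add[of y z] by (fastforce simp: chains_def lookup_add intro: polyS_add)
    ultimately show ?case by metis
  qed
  then obtain y where y: "y \<in> chains (S_mod d m) K (Suc p)"
    and g: "good n (w - lin_ext (*) (diff K (Suc p)) y)" by blast
  define w1 where "w1 = w - lin_ext (*) (diff K (Suc p)) y"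
  have w1: "w1 \<in> chains (S_mod d m) K p"
    unfolding w1_def using w bd_chains[OF y] by (rule chains_sub)
  \<comment> \<open>With all variables eliminated, only a constant at the empty set could be left.
    Then \<open>p = 0\<close>, and that constant is the augmentation of \<open>w1\<close>, which is
    0.\<close>
  have "w1 = 0"
  proof (rule poly_mapping_eq_set_encodeI)
    fix \<tau> :: "nat set" assume \<tau>: "finite \<tau>"
    have "lookup (lookup w1 (set_encode \<tau>)) u = 0" for u
    proof (rule ccontr)
      assume u: "lookup (lookup w1 (set_encode \<tau>)) u \<noteq> 0"
      then have u': "u \<in> keys (lookup w1 (set_encode \<tau>))" by (simp add: in_keys_iff)
      then have "lookup w1 (set_encode \<tau>) \<noteq> 0" by auto
      with lookup_set_encode_zero[OF chains_keys[OF w1[unfolded K_def]] \<tau>]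
      have sub: "\<tau> \<subseteq> {1..n}" "card \<tau> = p" by (auto simp: n_def)
      have "keys u \<subseteq> {1..n}"
        using chainsD[OF w1, of "set_encode \<tau>"] u' by (auto simp: polyS_def n_def)
      moreover have "(\<tau> \<union> keys u) \<inter> {1..n} = {}"
        using g \<tau> u' by (auto simp: good_def w1_def)
      ultimately have "\<tau> = {}" "keys u = {}" using sub by blast+
      then have "p = 0" "u = 0" using sub by auto
      moreover have "aug_map k_mod K w1 = 0"
        using cycle \<open>p = 0\<close> koszul_aug_bd[of y d m] y by (simp add: w1_def aug_map_k_diff K_def)
      ultimately show False
        using u aug_map_koszul[of w1 d m] w1 \<open>\<tau> = {}\<close> by (simp add: K_def)
    qed
    then show "lookup w1 (set_encode \<tau>) = lookup 0 (set_encode \<tau>)"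
      by (intro poly_mapping_eqI) simp
  qed
  with y show ?thesis by (auto simp: w1_def)
qed

theorem koszul_resolution:
  "graded_free_resolution d m k_mod (koszul d m :: ('k::field, 'k) free_complex)"
proof -
  let ?K = "koszul d m :: ('k, 'k) free_complex"
  have "(\<Sum>i\<in>set_decode g. avec d m i) \<in> zvecs m" if "g \<in> gens ?K p" for g p
    using that
  proof (rule gens_koszulE)
    fix \<sigma> assume "g = set_encode \<sigma>" "\<sigma> \<subseteq> {1..nvars d m}" "finite \<sigma>"
    then show ?thesis
      using avec_in_Avecs by (intro zvecs_sum) (auto simp: Avecs_def)
  qed
  moreover have "aug ?K g \<in> comp k_mod (gdeg ?K 0 g)" if "g \<in> gens ?K 0" for g
    using that by (auto simp: k_mod_def elim!: gens_koszulE)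
  moreover have "aug_map k_mod ?K ` chains (S_mod d m) ?K 0 = carr k_mod"
  proof -
    have "y \<in> aug_map k_mod ?K ` chains (S_mod d m) ?K 0" for y
    proof (rule image_eqI)
      have "0 \<in> gens ?K 0" using gens_koszul_iff[of "{}" d m 0] by simp
      then show w: "single 0 (single 0 y) \<in> chains (S_mod d m) ?K 0"
        by (auto simp: chains_def polyS_def lookup_single when_def)
      show "y = aug_map k_mod ?K (single 0 (single 0 y))"
        using aug_map_koszul[OF w] by simp
    qed
    then show ?thesis by (auto simp: k_mod_def)
  qed
  moreover have "{w \<in> chains (S_mod d m) ?K 0. aug_map k_mod ?K w = 0}
      = bd (S_mod d m) ?K 1 ` chains (S_mod d m) ?K 1"
    using koszul_exact[of _ d m 0] koszul_aug_bd koszul_bd_chains by (fastforce simp: bd_eq_ext)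
  moreover have "{w \<in> chains (S_mod d m) ?K p. bd (S_mod d m) ?K p w = 0}
      = bd (S_mod d m) ?K (p + 1) ` chains (S_mod d m) ?K (p + 1)" if "p \<ge> 1" for p
  proof -
    from that have "p \<noteq> 0" by simp
    then show ?thesis
      using koszul_exact[of _ d m p] koszul_bd_bd[of _ d m p] koszul_bd_chains[of _ d m p]
      by (fastforce simp: bd_eq_ext)
  qed
  ultimately show ?thesis
    unfolding graded_free_resolution_def
    by (intro conjI allI ballI impI koszul_diff_deg) (simp_all only: koszul_simps)
qed

section \<open>The Veronese semigroup\<close>

lemma total_add: "total m (v + w) = total m v + total m w"
  by (simp add: total_def lookup_add sum.distrib)

lemma total_diff: "total m (v - w) = total m v - total m w"
  by (simp add: total_def lookup_minus sum_subtractf)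

lemma total_zero [simp]: "total m 0 = 0"
  by (simp add: total_def)

lemma total_single: "r \<le> m \<Longrightarrow> total m (single r c) = c"
  by (simp add: total_def lookup_single when_def)

lemma zvecs_diff: "v \<in> zvecs m \<Longrightarrow> w \<in> zvecs m \<Longrightarrow> v - w \<in> zvecs m"
  using keys_diff_sub[of v w] by (auto simp: zvecs_def)

lemma zvecs_lookup: "v \<in> zvecs m \<Longrightarrow> m < r \<Longrightarrow> lookup v r = 0"
  by (auto simp: zvecs_def in_keys_iff)

text \<open>Grow \<open>a\<close> by one unit at a time: while its total is smaller than that of
  \<open>v\<close>, some coordinate still has room.\<close>

lemma exists_below_of_total:
  assumes "v \<in> zvecs m" "\<And>r. 0 \<le> lookup v r" "int t \<le> total m v"
  shows "\<exists>a\<in>Avecs t m. \<forall>r. lookup a r \<le> lookup v r"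
  using assms(3)
proof (induction t)
  case 0
  then show ?case
    using assms(2) by (intro bexI[of _ 0]) (auto simp: Avecs_def)
next
  case (Suc t)
  then obtain a where a: "a \<in> Avecs t m" "\<And>r. lookup a r \<le> lookup v r" by auto
  have "\<exists>r\<le>m. lookup a r < lookup v r"
  proof (rule ccontr)
    assume "\<not> ?thesis"
    then have "total m v \<le> total m a"
      unfolding total_def by (intro sum_mono) (auto simp: not_less)
    with Suc.prems a show False by (simp add: Avecs_def)
  qed
  then obtain r where r: "r \<le> m" "lookup a r < lookup v r" by blast
  have "single r 1 \<in> zvecs m" using r(1) by (simp add: zvecs_def)
  then have "a + single r 1 \<in> Avecs (Suc t) m"
    using a(1) r(1)
    by (auto simp: Avecs_def total_add total_single lookup_add lookup_single when_def
        intro: zvecs_add)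
  moreover have "lookup (a + single r 1) s \<le> lookup v s" for s
    using a(2)[of s] r by (auto simp: lookup_add lookup_single when_def)
  ultimately show ?case by blast
qed

text \<open>For the converse direction, split off a vector of total \<open>d\<close> below
  \<open>v\<close> and use induction on the total; by divisibility a non-zero total is at least
  \<open>d\<close>. Membership of a difference thus becomes a matter of the signs of its
  coordinates.\<close>

lemma NA_iff:
  "v \<in> NA d m \<longleftrightarrow> v \<in> zvecs m \<and> (\<forall>r. 0 \<le> lookup v r) \<and> int d dvd total m v"
proof (intro iffI conjI)
  assume "v \<in> NA d m"
  then have "v \<in> zvecs m \<and> (\<forall>r. 0 \<le> lookup v r) \<and> int d dvd total m v"
    by induction (auto simp: Avecs_def total_add lookup_add intro: zvecs_add)
  then show "v \<in> zvecs m" "\<forall>r. 0 \<le> lookup v r" "int d dvd total m v" by blast+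
next
  assume v: "v \<in> zvecs m \<and> (\<forall>r. 0 \<le> lookup v r) \<and> int d dvd total m v"
  then show "v \<in> NA d m"
  proof (induction "nat (total m v)" arbitrary: v rule: less_induct)
    case less
    have nonneg: "0 \<le> total m v"
      using less.prems by (auto simp: total_def intro: sum_nonneg)
    show ?case
    proof (cases "total m v = 0")
      case True
      have "\<forall>r\<in>{..m}. lookup v r = 0"
        using True less.prems sum_nonneg_eq_0_iff[of "{..m}" "lookup v"] by (auto simp: total_def)
      with less.prems have "v = 0"
        by (intro poly_mapping_eqI) (metis atMost_iff lookup_zero not_less zvecs_lookup)
      then show ?thesis by (simp add: NA.zero)
    next
      case False
      with nonneg less.prems have d: "int d \<le> total m v" "d \<noteq> 0"
        by (auto dest: zdvd_imp_le)
      with exists_below_of_total[of v m d] less.prems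
      obtain a where a: "a \<in> Avecs d m" "\<And>r. lookup a r \<le> lookup v r" by blast
      have "v - a \<in> NA d m"
        using a d less.prems
        by (intro less.hyps) (auto simp: total_diff Avecs_def lookup_minus intro: zvecs_diff)
      from NA.add[OF a(1) this] show ?thesis by simp
    qed
  qed
qed

lemma NA_add: "v \<in> NA d m \<Longrightarrow> w \<in> NA d m \<Longrightarrow> v + w \<in> NA d m"
  by (auto simp: NA_iff total_add lookup_add intro: zvecs_add)

lemma monom_deg_in_NA:
  assumes "keys u \<subseteq> {1..nvars d m}"
  shows "monom_deg d m u \<in> NA d m"
proof -
  have A: "avec d m i \<in> Avecs d m" if "i \<in> keys u" for i
    using assms that by (intro avec_in_Avecs) auto
  have l: "lookup (monom_deg d m u) r = (\<Sum>i\<in>keys u. int (lookup u i) * lookup (avec d m i) r)" for r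
    by (rule lookup_monom_deg) auto
  have "monom_deg d m u \<in> zvecs m"
  proof -
    have "lookup (monom_deg d m u) r = 0" if "m < r" for r
    proof -
      have "lookup (avec d m i) r = 0" if "i \<in> keys u" for i
        using A[OF that] \<open>m < r\<close> by (simp add: Avecs_def zvecs_lookup[of _ m])
      then show ?thesis by (simp add: l)
    qed
    then have "r \<le> m" if "r \<in> keys (monom_deg d m u)" for r
      using that by (meson in_keys_iff not_less)
    then show ?thesis by (simp add: zvecs_def subset_iff)
  qed
  moreover have "0 \<le> lookup (monom_deg d m u) r" for r
    using A unfolding l by (intro sum_nonneg) (auto simp: Avecs_def)
  moreover have "total m (monom_deg d m u) = (\<Sum>i\<in>keys u. int (lookup u i) * total m (avec d m i))"
    unfolding total_def l by (subst sum.swap) (simp add: sum_distrib_left)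
  then have "int d dvd total m (monom_deg d m u)"
    using A by (auto simp: Avecs_def intro!: dvd_sum)
  ultimately show ?thesis by (simp add: NA_iff)
qed

section \<open>The semigroup ring as a graded module\<close>

lemma veronese_hom_superset:
  "finite U \<Longrightarrow> keys f \<subseteq> U \<Longrightarrow>
    veronese_hom d m f = (\<Sum>u\<in>U. single (monom_deg d m u) (lookup f u))"
  unfolding veronese_hom_def by (rule sum.mono_neutral_left) (auto simp: in_keys_iff)

lemma veronese_hom_single: "veronese_hom d m (single u c) = single (monom_deg d m u) c"
  by (simp add: veronese_hom_superset[of "{u}"])

lemma veronese_hom_add: "veronese_hom d m (f + g) = veronese_hom d m f + veronese_hom d m g"
  using keys_add[of f g]
  by (simp add: veronese_hom_superset[of "keys f \<union> keys g"] lookup_add single_add sum.distrib)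

lemma veronese_hom_sum: "veronese_hom d m (sum f I) = (\<Sum>i\<in>I. veronese_hom d m (f i))"
  by (induction I rule: infinite_finite_induct) (simp_all add: veronese_hom_add, simp_all add: veronese_hom_def)

lemma poly_mapping_sum_single: "(\<Sum>u\<in>keys f. single u (lookup f u)) = f"
proof (rule poly_mapping_eqI)
  fix k
  have "lookup (\<Sum>u\<in>keys f. single u (lookup f u)) k = (\<Sum>u\<in>keys f. if u = k then lookup f u else 0)"
    by (simp add: lookup_sum lookup_single when_def)
  also have "\<dots> = lookup f k" by (simp add: in_keys_iff)
  finally show "lookup (\<Sum>u\<in>keys f. single u (lookup f u)) k = lookup f k" .
qed

lemma veronese_hom_mult: "veronese_hom d m (f * g) = veronese_hom d m f * veronese_hom d m g"
proof -
  have "f * g = (\<Sum>u\<in>keys f. \<Sum>v\<in>keys g. single u (lookup f u) * single v (lookup g v))"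
    by (subst (1) poly_mapping_sum_single[of f, symmetric], subst (1) poly_mapping_sum_single[of g, symmetric])
      (simp only: sum_product)
  then show ?thesis
    by (simp add: veronese_hom_sum veronese_hom_single mult_single monom_deg_add sum_product)
      (simp add: veronese_hom_def sum_product mult_single)
qed

lemma veronese_hom_X: "veronese_hom d m (X i) = single (avec d m i) 1"
  by (simp add: X_def veronese_hom_single del: One_nat_def)

lemma act_NA_mod: "act (NA_mod d m) f g = veronese_hom d m f * g"
  by (simp add: NA_mod_def)

lemma comp_NA_mod: "comp (NA_mod d m) b = {g. keys g \<subseteq> NA d m \<inter> {b}}"
  by (simp add: NA_mod_def)

lemma graded_action_NA_mod:
  "graded_action d m (NA_mod d m :: ('k::field, vec \<Rightarrow>\<^sub>0 'k) graded_module)"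
proof (rule graded_action.intro)
  have "veronese_hom d m 1 = (1 :: vec \<Rightarrow>\<^sub>0 'k)"
    using veronese_hom_single[of d m 0 "1::'k"] by simp
  then show "module (act (NA_mod d m :: ('k, vec \<Rightarrow>\<^sub>0 'k) graded_module))"
    by unfold_locales (simp_all add: act_NA_mod veronese_hom_add veronese_hom_mult algebra_simps)
next
  fix f :: "'k pol" and y :: "vec \<Rightarrow>\<^sub>0 'k" and a b
  assume f: "f \<in> homS d m a" and y: "y \<in> comp (NA_mod d m) b"
  have "k \<in> NA d m \<inter> {a + b}" if "k \<in> keys (veronese_hom d m f * y)" for k
  proof -
    from that keys_mult[of "veronese_hom d m f" y] obtain k1 k2
      where k: "k = k1 + k2" "k1 \<in> keys (veronese_hom d m f)" "k2 \<in> keys y" by blast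
    from k(2) obtain u where "u \<in> keys f" "k1 = monom_deg d m u"
      unfolding veronese_hom_def using keys_sum[of "\<lambda>u. single (monom_deg d m u) (lookup f u)" "keys f"]
      by (auto split: if_splits)
    with f have "k1 = a" "k1 \<in> NA d m"
      using monom_deg_in_NA[of u d m] by (auto simp: homS_iff polyS_def)
    moreover have "k2 = b" "k2 \<in> NA d m"
      using y k(3) by (auto simp: comp_NA_mod)
    ultimately show ?thesis using k(1) by (auto intro: NA_add)
  qed
  then show "act (NA_mod d m) f y \<in> comp (NA_mod d m) (a + b)"
    by (auto simp: act_NA_mod comp_NA_mod)
next
  fix x y :: "vec \<Rightarrow>\<^sub>0 'k" and b
  assume "x \<in> comp (NA_mod d m) b" "y \<in> comp (NA_mod d m) b"
  then show "x + y \<in> comp (NA_mod d m) b"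
    using keys_add[of x y] by (auto simp: comp_NA_mod)
qed (simp add: comp_NA_mod)

text \<open>The degree-\<open>b\<close> strand of the Koszul complex is the augmented chain complex of the simplicial
  complex of all \<open>\<sigma>\<close> with \<open>b - (\<Sum>i\<in>\<sigma>. a\<^sup>i) \<in> NA\<close>; the hypothesis says that it is a cone with
  apex \<open>v\<close>.\<close>

lemma koszul_acyclic_of_cone:
  assumes v: "v \<in> {1..nvars d m}"
    and cone: "\<And>\<sigma>. \<sigma> \<subseteq> {1..nvars d m} \<Longrightarrow> v \<notin> \<sigma> \<Longrightarrow> b - (\<Sum>i\<in>\<sigma>. avec d m i) \<in> NA d m
      \<Longrightarrow> b - (\<Sum>i\<in>\<sigma>. avec d m i) - avec d m v \<in> NA d m"
  shows "acyclic_deg (NA_mod d m :: ('k::field, vec \<Rightarrow>\<^sub>0 'k) graded_module)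
    (koszul d m :: ('k, 'k) free_complex) b"
  unfolding acyclic_deg_def
proof (intro allI ballI impI)
  let ?M = "NA_mod d m :: ('k, vec \<Rightarrow>\<^sub>0 'k) graded_module"
  let ?K = "koszul d m :: ('k, 'k) free_complex"
  define n where "n = nvars d m"
  \<comment> \<open>Division by the monomial of \<open>v\<close> takes place in the group ring and
    may leave k[NA]. That it does not do so on the entries of \<open>z\<close> is where the cone
    hypothesis enters.\<close>
  define D where "D = (\<lambda>g :: vec \<Rightarrow>\<^sub>0 'k. single (- avec d m v) 1 * g)"
  interpret M: graded_action d m ?M by (rule graded_action_NA_mod)
  interpret C: koszul_contraction "act ?M" n v D
  proof
    show "v \<in> {1..n}" using v by (simp add: n_def)
    show "D (x + y) = D x + D y" for x y by (simp add: D_def algebra_simps)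
    show "D (act ?M (X i) y) = act ?M (X i) (D y)" if "i \<noteq> v" for i y
      by (simp add: D_def act_NA_mod mult_ac)
    show "D (act ?M (X v) y) = y" for y
      by (simp add: D_def act_NA_mod veronese_hom_X mult_single mult.assoc[symmetric])
  qed
  fix p z assume z: "z \<in> chains_deg ?M ?K p b" and bz: "bd ?M ?K p z = 0"
  have kz: "keys z \<subseteq> gens ?K p" using z by (simp add: chains_deg_def)
  define y where "y = of_fun n (Suc p) (C.hom (\<lambda>\<sigma>. lookup z (set_encode \<sigma>)))"
  have "lin_ext (act ?M) (diff ?K (Suc p)) y = z"
  proof (rule poly_mapping_eq_set_encodeI)
    fix \<tau> :: "nat set" assume \<tau>: "finite \<tau>"
    have "p = 0 \<or> lin_ext (act ?M) (diff ?K p) z = 0"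
      using bz by (cases p) (simp_all add: bd_Suc)
    note C.lookup_bd_of_fun_hom[OF n_def kz \<tau> this, folded y_def]
    then show "lookup (lin_ext (act ?M) (diff ?K (Suc p)) y) (set_encode \<tau>) = lookup z (set_encode \<tau>)"
      by (simp add: D_def act_NA_mod veronese_hom_X mult_single mult.assoc[symmetric])
  qed
  moreover have "y \<in> chains_deg ?M ?K (Suc p) b"
    unfolding chains_deg_def
  proof (intro CollectI conjI ballI)
    show "keys y \<subseteq> gens ?K (Suc p)"
      unfolding y_def n_def by (rule keys_of_fun)
    fix g assume "g \<in> gens ?K (Suc p)"
    then obtain \<sigma> where \<sigma>: "g = set_encode \<sigma>" "\<sigma> \<subseteq> {1..nvars d m}" "card \<sigma> = Suc p" "finite \<sigma>"
      by (rule gens_koszulE)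
    have "C.hom (\<lambda>\<sigma>. lookup z (set_encode \<sigma>)) \<sigma> \<in> comp ?M (b - (\<Sum>i\<in>\<sigma>. avec d m i))"
    proof (cases "v \<in> \<sigma>")
      case False
      then show ?thesis by (simp add: C.hom_def M.comp_zero)
    next
      case True
      let ?\<rho> = "\<sigma> - {v}" and ?x = "lookup z (set_encode (\<sigma> - {v}))"
      have sum: "(\<Sum>i\<in>\<sigma>. avec d m i) = avec d m v + (\<Sum>i\<in>?\<rho>. avec d m i)"
        using True \<sigma>(4) by (rule sum.remove[rotated])
      have x: "?x \<in> comp ?M (b - (\<Sum>i\<in>?\<rho>. avec d m i))"
        using M.chains_degD[OF z, of "set_encode ?\<rho>"] \<sigma>(4) by simp
      have "k \<in> NA d m \<inter> {b - (\<Sum>i\<in>\<sigma>. avec d m i)}" if k: "k \<in> keys (D ?x)" for k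
      proof -
        from k keys_mult[of "single (- avec d m v) (1::'k)" ?x] obtain l
          where l: "l \<in> keys ?x" "k = l - avec d m v" by (auto simp: D_def)
        with x have l': "l = b - (\<Sum>i\<in>?\<rho>. avec d m i)" "l \<in> NA d m"
          by (auto simp: comp_NA_mod)
        then have "b - (\<Sum>i\<in>?\<rho>. avec d m i) - avec d m v \<in> NA d m"
          using \<sigma>(2) by (intro cone) auto
        moreover have "k = b - (\<Sum>i\<in>\<sigma>. avec d m i)"
          unfolding l(2) l'(1) sum by (simp only: diff_diff_eq add.commute)
        ultimately show ?thesis
          by (simp add: l(2) l'(1))
      qed
      then have "D ?x \<in> comp ?M (b - (\<Sum>i\<in>\<sigma>. avec d m i))"
        by (auto simp: comp_NA_mod)
      moreover have "eps v ?\<rho> \<in> homS d m (0 :: vec)"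
        by (simp add: eps_def minus_one_power_iff homS_iff polyS_def)
      ultimately show ?thesis
        using M.comp_act[of "eps v ?\<rho>" 0 "D ?x"] True by (simp add: C.hom_def)
    qed
    with \<sigma> show "lookup y g \<in> comp ?M (b - gdeg ?K (Suc p) g)"
      by (simp add: y_def lookup_of_fun n_def)
  qed
  ultimately show "\<exists>y\<in>chains_deg ?M ?K (Suc p) b. bd ?M ?K (Suc p) y = z"
    by (auto simp: bd_Suc)
qed

section \<open>From exactness to vanishing Betti numbers\<close>

lemma quotient_dim_self:
  assumes "module scale" "0 \<in> Z"
  shows "quotient_dim scale Z Z = 0"
proof -
  interpret module scale by fact
  \<comment> \<open>\<open>quotient_dim\<close> takes the cardinality of a basis selected by
    \<open>SOME\<close>, so every basis has to be shown empty: its elements lie in the span and in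
    \<open>Z\<close>, hence are 0, and 0 is never part of an independent set.\<close>
  have "X = {}" if "quotient_basis scale Z Z X" for X
  proof -
    have "X \<subseteq> span X \<inter> Z"
      using that span_superset by (auto simp: quotient_basis_def)
    with that have "X \<subseteq> {0}" "independent X" by (auto simp: quotient_basis_def)
    then show ?thesis using dependent_zero by blast
  qed
  moreover have "quotient_basis scale Z Z {}"
    using assms(2) independent_empty by (auto simp: quotient_basis_def)
  ultimately have "(SOME X. finite X \<and> quotient_basis scale Z Z X) = {}"
    "\<exists>X. finite X \<and> quotient_basis scale Z Z X"
    by (metis (mono_tags, lifting) finite.emptyI someI)+
  then show ?thesis by (simp add: quotient_dim_def zero_enat_def)
qed

lemma (in k_resolution) bd_bd:
  assumes "graded_action d m Y" "w \<in> chains_deg Y F (Suc p) b"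
  shows "bd Y F p (bd Y F (Suc p) w) = 0"
proof (cases p)
  case 0
  then show ?thesis by (simp add: bd_def)
next
  case (Suc q)
  interpret Y: graded_action d m Y by fact
  have "bd Y F p (bd Y F (Suc p) w) = lin_ext (act Y) (\<lambda>g. lin_ext (*) (diff F p) (diff F (Suc p) g)) w"
    using Suc by (simp add: bd_Suc Y.lin_ext_ext)
  also have "\<dots> = lin_ext (act Y) (\<lambda>g. 0) w"
    using assms(2) cycle_diff Suc by (intro Y.lin_ext_cong) (auto simp: chains_deg_def cycle_def)
  finally show ?thesis by (simp add: lin_ext_def)
qed

text \<open>The Koszul complex enters twice: as the witness that makes \<open>SOME\<close> return a
  resolution at all, and as the complex whose acyclicity is transferred to that resolution.\<close>

lemma betti_eq_zero_of_acyclic: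
  assumes "acyclic_deg (NA_mod d m :: ('k::field, vec \<Rightarrow>\<^sub>0 'k) graded_module)
    (koszul d m :: ('k, 'k) free_complex) b"
  shows "betti TYPE('k) d m p b = 0"
proof -
  let ?M = "NA_mod d m :: ('k, vec \<Rightarrow>\<^sub>0 'k) graded_module"
  define F where "F = (SOME F :: ('k, 'k) free_complex. graded_free_resolution d m k_mod F)"
  have "graded_free_resolution d m k_mod F"
    unfolding F_def by (rule someI[of "graded_free_resolution d m k_mod", OF koszul_resolution])
  then interpret F: k_resolution d m F by unfold_locales
  interpret M: graded_action d m ?M by (rule graded_action_NA_mod)
  have "k_resolution d m (koszul d m :: ('k, 'k) free_complex)"
    by unfold_locales (rule koszul_resolution)
  with assms have acyc: "acyclic_deg ?M F b"
    using acyclic_deg_transfer F.k_resolution_axioms graded_action_NA_mod by blast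
  have eq: "{w \<in> chains_deg ?M F q b. bd ?M F q w = 0} = bd ?M F (q + 1) ` chains_deg ?M F (q + 1) b" for q
  proof (intro equalityI subsetI)
    fix z assume "z \<in> {w \<in> chains_deg ?M F q b. bd ?M F q w = 0}"
    then show "z \<in> bd ?M F (q + 1) ` chains_deg ?M F (q + 1) b"
      using acyc by (auto simp: acyclic_deg_def)
  next
    fix z assume "z \<in> bd ?M F (q + 1) ` chains_deg ?M F (q + 1) b"
    then obtain y where y: "y \<in> chains_deg ?M F (Suc q) b" "z = bd ?M F (Suc q) y" by auto
    then have "z \<in> chains_deg ?M F q b"
      using M.lin_ext_chains_deg[OF y(1) F.diff_deg] by (simp add: bd_Suc)
    with F.bd_bd[OF graded_action_NA_mod y(1)] y(2)
    show "z \<in> {w \<in> chains_deg ?M F q b. bd ?M F q w = 0}" by simp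
  qed
  have mod: "module (chain_scale ?M)"
  proof -
    have l: "lookup (chain_scale ?M c w) g = single 0 c * lookup w g" for c w g
      by (simp add: chain_scale_def act_NA_mod veronese_hom_single Poly_Mapping.map.rep_eq when_def)
    show ?thesis
      by unfold_locales
        (auto intro!: poly_mapping_eqI simp: l lookup_add single_add algebra_simps mult_single
          mult.assoc[symmetric])
  qed
  have "0 \<in> {w \<in> chains_deg ?M F q b. bd ?M F q w = 0}" for q
    by (simp add: M.zero_chains_deg bd_def)
  from quotient_dim_self[OF mod this]
  have "tor_dim d m ?M (k_mod :: ('k, 'k) graded_module) q b = 0" for q
    unfolding tor_dim_def Let_def F_def[symmetric] eq[symmetric] .
  then show ?thesis by (simp add: betti_def)
qed

section \<open>The threshold\<close>

abbreviation acoord :: "nat \<Rightarrow> nat \<Rightarrow> nat \<Rightarrow> nat \<Rightarrow> int" where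
  "acoord d m r i \<equiv> lookup (avec d m i) r"

lemma acoord_nonneg: "i \<in> {1..nvars d m} \<Longrightarrow> 0 \<le> acoord d m r i"
  using avec_in_Avecs by (simp add: Avecs_def)

lemma avec_surj: "a \<in> Avecs d m \<Longrightarrow> \<exists>i\<in>{1..nvars d m}. avec d m i = a"
  using bij_betw_avec[of d m] unfolding bij_betw_def by (metis imageE)

lemma avec_inj: "i \<in> {1..nvars d m} \<Longrightarrow> i' \<in> {1..nvars d m} \<Longrightarrow> avec d m i = avec d m i' \<Longrightarrow> i = i'"
  using bij_betw_avec[of d m] unfolding bij_betw_def inj_on_def by blast

lemma finite_Cset: "finite (Cset d m l)"
  by (rule finite_subset[of _ "Pow {1..nvars d m}"]) (auto simp: Cset_def)

lemma fmax_ge: "\<sigma> \<in> Cset d m l \<Longrightarrow> (\<Sum>i\<in>\<sigma>. acoord d m 1 i) \<le> fmax d m l"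
  unfolding fmax_def by (rule Max_ge) (auto simp: finite_Cset)

lemma fmax_attained: "Cset d m l \<noteq> {} \<Longrightarrow> \<exists>\<sigma>\<in>Cset d m l. fmax d m l = (\<Sum>i\<in>\<sigma>. acoord d m 1 i)"
  using Max_in[of "(\<lambda>\<sigma>. \<Sum>i\<in>\<sigma>. acoord d m 1 i) ` Cset d m l"] finite_Cset
  unfolding fmax_def by blast

text \<open>Either add a vector with coordinate 0 equal to 1, or exchange \<open>a - e\<^sub>0 + e\<^sub>2\<close> for \<open>a\<close>; neither
  decreases the sum of the coordinates 1.\<close>

lemma Cset_step:
  assumes "m \<ge> 2" and \<sigma>: "\<sigma> \<in> Cset d m l" and "l < (\<Sum>i = 1..nvars d m. acoord d m 0 i)"
  shows "\<exists>\<sigma>'\<in>Cset d m (l + 1). (\<Sum>i\<in>\<sigma>. acoord d m 1 i) \<le> (\<Sum>i\<in>\<sigma>'. acoord d m 1 i)"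
proof -
  let ?n = "nvars d m"
  have sub: "\<sigma> \<subseteq> {1..?n}" and l: "(\<Sum>i\<in>\<sigma>. acoord d m 0 i) = l"
    using \<sigma> by (auto simp: Cset_def)
  have fin: "finite \<sigma>" using sub by (rule subset_atLeastAtMost_finite)
  have "\<exists>i. i \<in> {1..?n} - \<sigma> \<and> acoord d m 0 i > 0"
  proof (rule ccontr)
    assume "\<not> ?thesis"
    then have "acoord d m 0 i = 0" if "i \<in> {1..?n} - \<sigma>" for i
      using that acoord_nonneg[of i d m 0] by force
    then have "(\<Sum>i = 1..?n. acoord d m 0 i) = (\<Sum>i\<in>\<sigma>. acoord d m 0 i)"
      using sub by (intro sum.mono_neutral_right) auto
    with l assms(3) show False by simp
  qed
  \<comment> \<open>The minimal choice makes the exchange possible: a vector whose coordinate 0 is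
    smaller by one, but still positive, must already belong to \<open>\<sigma>\<close>.\<close>
  from ex_has_least_nat[of "\<lambda>i. i \<in> {1..?n} - \<sigma> \<and> acoord d m 0 i > 0" _ "\<lambda>i. nat (acoord d m 0 i)"] this
  obtain i where i: "i \<in> {1..?n} - \<sigma>" "acoord d m 0 i > 0"
    and least: "\<And>i'. i' \<in> {1..?n} - \<sigma> \<Longrightarrow> acoord d m 0 i' > 0 \<Longrightarrow> nat (acoord d m 0 i) \<le> nat (acoord d m 0 i')"
    by blast
  show ?thesis
  proof (cases "acoord d m 0 i = 1")
    case True
    have "insert i \<sigma> \<in> Cset d m (l + 1)"
      using i sub l fin True by (auto simp: Cset_def)
    moreover have "(\<Sum>i\<in>\<sigma>. acoord d m 1 i) \<le> (\<Sum>i\<in>insert i \<sigma>. acoord d m 1 i)"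
      using i fin acoord_nonneg[of i d m 1] by simp
    ultimately show ?thesis by blast
  next
    case False
    define a where "a = avec d m i - single 0 1 + single 2 1"
    have "single 0 1 \<in> zvecs m" "single 2 1 \<in> zvecs m"
      using assms(1) by (auto simp: zvecs_def simp del: single_one)
    moreover have Ai: "avec d m i \<in> Avecs d m" using i avec_in_Avecs by blast
    ultimately have "a \<in> Avecs d m"
      using i(2) assms(1)
      by (auto simp: a_def Avecs_def total_add total_diff total_single lookup_add lookup_minus
          lookup_single when_def simp del: single_one intro: zvecs_add zvecs_diff)
    then obtain i' where i': "i' \<in> {1..?n}" "avec d m i' = a" using avec_surj by blast
    then have c: "acoord d m 0 i' = acoord d m 0 i - 1" "acoord d m 1 i' = acoord d m 1 i"
      by (auto simp: a_def lookup_add lookup_minus lookup_single when_def simp del: single_one)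
    then have "acoord d m 0 i' > 0" "nat (acoord d m 0 i') < nat (acoord d m 0 i)"
      using i(2) False by auto
    with least[of i'] i'(1) have "i' \<in> \<sigma>" by force
    have s: "(\<Sum>k\<in>insert i (\<sigma> - {i'}). acoord d m r k) = (\<Sum>k\<in>\<sigma>. acoord d m r k) + acoord d m r i - acoord d m r i'" for r
      using fin i(1) \<open>i' \<in> \<sigma>\<close> by (simp add: sum.remove[of \<sigma> i'])
    have "insert i (\<sigma> - {i'}) \<in> Cset d m (l + 1)"
      using s[of 0] c(1) l sub i(1) by (auto simp: Cset_def)
    moreover have "(\<Sum>i\<in>\<sigma>. acoord d m 1 i) \<le> (\<Sum>k\<in>insert i (\<sigma> - {i'}). acoord d m 1 k)"
      using s[of 1] c(2) by simp
    ultimately show ?thesis by blast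
  qed
qed

lemma Cset_sum_le_fmax:
  assumes "m \<ge> 2" and "\<sigma> \<in> Cset d m l" and "l \<le> l'" and "l' \<le> (\<Sum>i = 1..nvars d m. acoord d m 0 i)"
  shows "(\<Sum>i\<in>\<sigma>. acoord d m 1 i) \<le> fmax d m l'"
proof -
  from assms(3,4) have "\<exists>\<sigma>'\<in>Cset d m l'. (\<Sum>i\<in>\<sigma>. acoord d m 1 i) \<le> (\<Sum>i\<in>\<sigma>'. acoord d m 1 i)"
  proof (induction l' rule: int_ge_induct)
    case base
    then show ?case using assms(2) by blast
  next
    case (step k)
    then obtain \<sigma>' where s': "\<sigma>' \<in> Cset d m k" "(\<Sum>i\<in>\<sigma>. acoord d m 1 i) \<le> (\<Sum>i\<in>\<sigma>'. acoord d m 1 i)"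
      by auto
    moreover obtain \<sigma>'' where "\<sigma>'' \<in> Cset d m (k + 1)" "(\<Sum>i\<in>\<sigma>'. acoord d m 1 i) \<le> (\<Sum>i\<in>\<sigma>''. acoord d m 1 i)"
      using Cset_step[OF assms(1) s'(1)] step.prems by auto
    ultimately show ?case by (meson order_trans)
  qed
  then show ?thesis using fmax_ge order_trans by blast
qed

text \<open>The transposition of the coordinates 1 and \<open>s\<close> maps the set of exponent
  vectors to itself and fixes coordinate 0, as \<open>s \<ge> 1\<close>; \<open>g\<close> is the
  permutation of the indices that it induces.\<close>

lemma coordinate_swap:
  assumes "s \<in> {1..m}"
  obtains g where "inj_on g {1..nvars d m}" "g ` {1..nvars d m} \<subseteq> {1..nvars d m}"
    "\<And>i. i \<in> {1..nvars d m} \<Longrightarrow> acoord d m 0 (g i) = acoord d m 0 i"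
    "\<And>i. i \<in> {1..nvars d m} \<Longrightarrow> acoord d m 1 (g i) = acoord d m s i"
proof -
  let ?n = "nvars d m"
  define t where "t r = (if r = 1 then s else if r = s then 1 else r)" for r
  have tt: "t (t r) = r" for r by (auto simp: t_def)
  then have inj: "inj t" by (metis injI)
  define sw where "sw v = Poly_Mapping.map_key t v" for v :: vec
  have lsw: "lookup (sw v) r = lookup v (t r)" for v r
    using inj by (simp add: sw_def map_key.rep_eq)
  have swsw: "sw (sw v) = v" for v
    by (rule poly_mapping_eqI) (simp add: lsw tt)
  have tm: "t r \<le> m \<longleftrightarrow> r \<le> m" for r using assms by (auto simp: t_def)
  have swA: "sw v \<in> Avecs d m" if v: "v \<in> Avecs d m" for v
  proof -
    have "total m (sw v) = total m v"
      unfolding total_def lsw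
      by (rule sum.reindex_bij_witness[of _ t t]) (auto simp: tt tm)
    moreover have "sw v \<in> zvecs m"
      unfolding zvecs_def
    proof (intro CollectI subsetI)
      fix r assume "r \<in> keys (sw v)"
      then have "t r \<in> keys v" by (simp add: in_keys_iff lsw)
      with v have "t r \<le> m" by (auto simp: Avecs_def zvecs_def)
      then show "r \<in> {..m}" by (simp add: tm)
    qed
    ultimately show ?thesis using v by (simp add: Avecs_def lsw)
  qed
  have "\<exists>i'\<in>{1..?n}. avec d m i' = sw (avec d m i)" if "i \<in> {1..?n}" for i
    using avec_surj[OF swA[OF avec_in_Avecs[OF that]]] .
  then obtain g where g: "\<And>i. i \<in> {1..?n} \<Longrightarrow> g i \<in> {1..?n} \<and> avec d m (g i) = sw (avec d m i)"
    by metis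
  have "t 0 = 0" "t 1 = s" using assms by (auto simp: t_def)
  then have "acoord d m 0 (g i) = acoord d m 0 i" "acoord d m 1 (g i) = acoord d m s i"
    if "i \<in> {1..?n}" for i
    using g[OF that] by (auto simp: lsw)
  moreover have "inj_on g {1..?n}"
    by (rule inj_onI) (metis g swsw avec_inj)
  moreover have "g ` {1..?n} \<subseteq> {1..?n}" using g by blast
  ultimately show ?thesis using that by blast
qed

lemma sum_acoord_le_fmax:
  assumes "m \<ge> 2" "s \<in> {1..m}" "\<sigma> \<subseteq> {1..nvars d m}"
    and "(\<Sum>i\<in>\<sigma>. acoord d m 0 i) \<le> l" "l \<le> (\<Sum>i = 1..nvars d m. acoord d m 0 i)"
  shows "(\<Sum>i\<in>\<sigma>. acoord d m s i) \<le> fmax d m l"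
proof -
  obtain g where g: "inj_on g {1..nvars d m}" "g ` {1..nvars d m} \<subseteq> {1..nvars d m}"
    "\<And>i. i \<in> {1..nvars d m} \<Longrightarrow> acoord d m 0 (g i) = acoord d m 0 i"
    "\<And>i. i \<in> {1..nvars d m} \<Longrightarrow> acoord d m 1 (g i) = acoord d m s i"
    using coordinate_swap[OF assms(2), of d] by metis
  have inj: "inj_on g \<sigma>" using g(1) assms(3) by (rule inj_on_subset)
  have "(\<Sum>i\<in>g ` \<sigma>. acoord d m 0 i) = (\<Sum>i\<in>\<sigma>. acoord d m 0 i)"
    using assms(3) g(3) by (auto simp: sum.reindex[OF inj] intro!: sum.cong)
  then have "g ` \<sigma> \<in> Cset d m (\<Sum>i\<in>\<sigma>. acoord d m 0 i)"
    using assms(3) g(2) by (auto simp: Cset_def)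
  from Cset_sum_le_fmax[OF assms(1) this assms(4,5)]
  have "(\<Sum>i\<in>g ` \<sigma>. acoord d m 1 i) \<le> fmax d m l" .
  also have "(\<Sum>i\<in>g ` \<sigma>. acoord d m 1 i) = (\<Sum>i\<in>\<sigma>. acoord d m s i)"
    using assms(3) g(4) by (auto simp: sum.reindex[OF inj] intro!: sum.cong)
  finally show ?thesis .
qed

text \<open>Dropping coordinate 0 embeds these vectors into the lists of \<open>m\<close> natural
  numbers with sum \<open>d\<close>, which are counted by stars and bars.\<close>

lemma card_acoord0_zero:
  assumes "m \<ge> 1"
  shows "card {i \<in> {1..nvars d m}. acoord d m 0 i = 0} \<le> (d + m - 1) choose (m - 1)"
proof -
  let ?Z = "{i \<in> {1..nvars d m}. acoord d m 0 i = 0}"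
  let ?f = "\<lambda>i. map (\<lambda>r. nat (acoord d m r i)) [1..<Suc m]"
  have img: "?f ` ?Z \<subseteq> {l. length l = m \<and> sum_list l = d}"
  proof (rule image_subsetI)
    fix i assume i: "i \<in> ?Z"
    then have A: "avec d m i \<in> Avecs d m" using avec_in_Avecs by blast
    have "{..m} = insert 0 {1..<Suc m}" by auto
    then have "int d = (\<Sum>r\<in>{1..<Suc m}. acoord d m r i)"
      using A i by (simp add: Avecs_def total_def)
    also have "\<dots> = int (\<Sum>r\<in>{1..<Suc m}. nat (acoord d m r i))"
      using A by (simp add: Avecs_def)
    finally have "sum_list (?f i) = d"
      by (simp only: sum_set_upt_conv_sum_list_nat[symmetric] set_upt of_nat_eq_iff)
    then show "?f i \<in> {l. length l = m \<and> sum_list l = d}" by simp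
  qed
  have inj: "inj_on ?f ?Z"
  proof (rule inj_onI)
    fix i i' assume i: "i \<in> ?Z" "i' \<in> ?Z" and eq: "?f i = ?f i'"
    then have A: "avec d m i \<in> Avecs d m" "avec d m i' \<in> Avecs d m" using avec_in_Avecs by auto
    have "avec d m i = avec d m i'"
    proof (rule poly_mapping_eqI)
      fix r
      consider "r = 0" | "r \<in> {1..<Suc m}" | "m < r" by force
      then show "acoord d m r i = acoord d m r i'"
      proof cases
        case 1
        with i show ?thesis by simp
      next
        case 2
        then have "nat (acoord d m r i) = nat (acoord d m r i')"
          using eq by (simp del: upt_Suc)
        moreover have "0 \<le> acoord d m r i" "0 \<le> acoord d m r i'"
          using A by (auto simp: Avecs_def)
        ultimately show ?thesis by linarith
      next
        case 3
        with A show ?thesis by (simp add: Avecs_def zvecs_lookup[of _ m])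
      qed
    qed
    with i show "i = i'" using avec_inj by blast
  qed
  have fin: "finite {l :: nat list. length l = m \<and> sum_list l = d}"
  proof (rule finite_subset)
    show "{l :: nat list. length l = m \<and> sum_list l = d} \<subseteq> {l. set l \<subseteq> {..d} \<and> length l = m}"
      using member_le_sum_list by fastforce
    show "finite {l. set l \<subseteq> {..d} \<and> length l = m}"
      by (rule finite_lists_length_eq) simp
  qed
  have "card ?Z = card (?f ` ?Z)" using inj by (simp add: card_image)
  also have "\<dots> \<le> card {l :: nat list. length l = m \<and> sum_list l = d}"
    using img fin by (rule card_mono[rotated])
  also have "\<dots> = (d + m - 1) choose d" by (rule card_length_sum_list)
  also have "\<dots> = (d + m - 1) choose (m - 1)"
    using assms by (subst binomial_symmetric) auto
  finally show ?thesis .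
qed

text \<open>Sets with sum 0 contain only vectors whose coordinate 0 is 0, so \<open>f\<close> at 0
  is at most the sum of the coordinates 1 over all such vectors. By symmetry each of the coordinates
  1 to \<open>m\<close> gives the same sum, and together they give \<open>d\<close> for each vector.
  This is the source of the binomial bound on \<open>j\<close>.\<close>

lemma fmax_zero_le:
  assumes "m \<ge> 1"
  shows "int m * fmax d m 0 \<le> int d * int ((d + m - 1) choose (m - 1))"
proof -
  let ?Z = "{i \<in> {1..nvars d m}. acoord d m 0 i = 0}"
  have "{} \<in> Cset d m 0" by (simp add: Cset_def)
  then obtain \<sigma> where \<sigma>: "\<sigma> \<in> Cset d m 0" "fmax d m 0 = (\<Sum>i\<in>\<sigma>. acoord d m 1 i)"
    using fmax_attained[of d m 0] by blast
  have fin: "finite \<sigma>" "\<sigma> \<subseteq> {1..nvars d m}"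
    using \<sigma>(1) subset_atLeastAtMost_finite by (auto simp: Cset_def)
  then have "acoord d m 0 i = 0" if "i \<in> \<sigma>" for i
    using that \<sigma>(1) sum_nonneg_eq_0_iff[of \<sigma> "acoord d m 0"] acoord_nonneg
    by (fastforce simp: Cset_def)
  with fin have "\<sigma> \<subseteq> ?Z" by blast
  then have le: "fmax d m 0 \<le> (\<Sum>i\<in>?Z. acoord d m 1 i)"
    unfolding \<sigma>(2) using acoord_nonneg by (intro sum_mono2) auto
  have sym: "(\<Sum>i\<in>?Z. acoord d m 1 i) = (\<Sum>i\<in>?Z. acoord d m s i)" if s: "s \<in> {1..m}" for s
  proof -
    obtain g where g: "inj_on g {1..nvars d m}" "g ` {1..nvars d m} \<subseteq> {1..nvars d m}"
      "\<And>i. i \<in> {1..nvars d m} \<Longrightarrow> acoord d m 0 (g i) = acoord d m 0 i"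
      "\<And>i. i \<in> {1..nvars d m} \<Longrightarrow> acoord d m 1 (g i) = acoord d m s i"
      using coordinate_swap[OF s, of d] by metis
    have inj: "inj_on g ?Z" using g(1) by (rule inj_on_subset) auto
    have "g i \<in> ?Z" if "i \<in> ?Z" for i
    proof -
      from that have i: "i \<in> {1..nvars d m}" by blast
      then have "g i \<in> {1..nvars d m}" using g(2) by (rule subsetD[OF _ imageI, rotated])
      with g(3)[OF i] that show ?thesis by simp
    qed
    then have "g ` ?Z \<subseteq> ?Z" by blast
    then have "g ` ?Z = ?Z" using inj by (intro endo_inj_surj) auto
    then have "(\<Sum>i\<in>?Z. acoord d m 1 i) = (\<Sum>i\<in>?Z. acoord d m 1 (g i))"
      using sum.reindex[OF inj, of "acoord d m 1"] by simp
    also have "\<dots> = (\<Sum>i\<in>?Z. acoord d m s i)"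
      using g(4) by (intro sum.cong) auto
    finally show ?thesis .
  qed
  have "int m * fmax d m 0 \<le> int m * (\<Sum>i\<in>?Z. acoord d m 1 i)"
    using le by (intro mult_left_mono) auto
  also have "\<dots> = (\<Sum>s\<in>{1..m}. \<Sum>i\<in>?Z. acoord d m 1 i)"
    by simp
  also have "\<dots> = (\<Sum>s\<in>{1..m}. \<Sum>i\<in>?Z. acoord d m s i)"
    by (rule sum.cong[OF refl sym])
  also have "\<dots> = (\<Sum>i\<in>?Z. \<Sum>s\<in>{1..m}. acoord d m s i)"
    by (rule sum.swap)
  also have "\<dots> = (\<Sum>i\<in>?Z. int d)"
  proof (intro sum.cong refl)
    fix i assume i: "i \<in> ?Z"
    have "{..m} = insert 0 {1..m}" by auto
    with i avec_in_Avecs[of i d m] show "(\<Sum>s\<in>{1..m}. acoord d m s i) = int d"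
      by (simp add: Avecs_def total_def)
  qed
  also have "\<dots> = int d * int (card ?Z)" by simp
  also have "\<dots> \<le> int d * int ((d + m - 1) choose (m - 1))"
    using card_acoord0_zero[OF assms, of d] by (intro mult_left_mono) auto
  finally show ?thesis .
qed

section \<open>The maximum defining the threshold\<close>

lemma nvars_pos: "0 < nvars d m"
proof -
  have "single 0 (int d) \<in> Avecs d m"
    by (auto simp: Avecs_def zvecs_def total_single lookup_single when_def simp del: single_of_nat)
  then show ?thesis using finite_Avecs by (auto simp: nvars_def card_gt_0_iff)
qed

text \<open>The sorted list is reversed, so its first entry is lexicographically at least
  \<open>single 0 (int d)\<close>, and coordinate 0 is compared first. For \<open>d \<ge> 1\<close>
  this makes \<open>Asum\<close> positive, so that 0 is an admissible value of
  \<open>l\<close>.\<close>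

lemma acoord_first: "int d \<le> acoord d m 0 1"
proof -
  let ?L = "sorted_list_of_set (Avecs d m)"
  have len: "length ?L = nvars d m" by (simp add: nvars_def)
  have mem: "single 0 (int d) \<in> Avecs d m"
    by (auto simp: Avecs_def zvecs_def total_single lookup_single when_def simp del: single_of_nat)
  then have "single 0 (int d) \<in> set ?L" by (simp add: finite_Avecs del: single_of_nat)
  then obtain k where k: "k < length ?L" "?L ! k = single 0 (int d)"
    by (auto simp: in_set_conv_nth)
  have "avec d m 1 = ?L ! (length ?L - 1)"
    using nvars_pos[of d m] len by (simp add: avec_def rev_nth del: sorted_list_of_set.length_sorted_key_list_of_set)
  moreover have "?L ! k \<le> ?L ! (length ?L - 1)"
    using k(1) by (intro sorted_nth_mono) auto
  ultimately have "single 0 (int d) \<le> avec d m 1" using k(2) by (simp del: single_of_nat)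
  then have "single 0 (int d) = avec d m 1 \<or> less_fun (lookup (single 0 (int d))) (lookup (avec d m 1))"
    by (simp only: less_eq_poly_mapping.rep_eq poly_mapping_eq_iff) blast
  then show ?thesis
  proof
    assume "single 0 (int d) = avec d m 1"
    then show ?thesis by (metis lookup_single_eq order_refl)
  next
    assume "less_fun (lookup (single 0 (int d))) (lookup (avec d m 1))"
    then obtain k where k: "lookup (single 0 (int d)) k < acoord d m k 1"
      "\<And>k'. k' < k \<Longrightarrow> lookup (single 0 (int d)) k' = acoord d m k' 1"
      using less_funE by blast
    show ?thesis
    proof (cases "k = 0")
      case True
      with k(1) show ?thesis by (simp del: single_of_nat)
    next
      case False
      with k(2)[of 0] show ?thesis by (simp del: single_of_nat)
    qed
  qed
qed

text \<open>\<open>Max\<close> is meaningful only on a non-empty finite set; the value 0 belongs to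
  this one, the bound on \<open>j\<close> giving \<open>phi d m j 0 \<ge> 0\<close>.\<close>

lemma ltilde_in:
  assumes "d \<ge> 1" "m \<ge> 1" "j \<ge> (d + m - 1) choose (m - 1)"
  shows "ltilde d m j \<in> {l \<in> {0..Asum d m j - 1}. phi d m j l \<ge> 0}"
proof -
  have "0 < (d + m - 1) choose (m - 1)" by (simp add: zero_less_binomial_iff)
  with assms(3) have "1 \<le> j" by linarith
  then have "1 \<le> min j (nvars d m)" using nvars_pos[of d m] by simp
  then have "acoord d m 0 1 \<le> Asum d m j"
    unfolding Asum_def by (intro member_le_sum) (auto intro: acoord_nonneg)
  with acoord_first[of d m] assms(1) have "0 \<le> Asum d m j - 1" by linarith
  moreover have "phi d m j 0 \<ge> 0"
  proof -
    have "int m * fmax d m 0 \<le> int d * int j"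
      using fmax_zero_le[OF assms(2), of d] assms(3)
      by (meson mult_left_mono of_nat_0_le_iff of_nat_le_iff order_trans)
    then have "real m * real_of_int (fmax d m 0) \<le> real d * real j"
      by (metis of_int_le_iff of_int_mult of_int_of_nat_eq)
    then have "real_of_int (fmax d m 0) \<le> (real d * real j - real_of_int 0) / real m"
      using assms(2) by (simp add: field_simps)
    then have "fmax d m 0 \<le> \<lceil>(real d * real j - real_of_int 0) / real m\<rceil>"
      by linarith
    then show ?thesis by (simp only: phi_def)
  qed
  ultimately have "0 \<in> {l \<in> {0..Asum d m j - 1}. phi d m j l \<ge> 0}" by simp
  then show ?thesis
    unfolding ltilde_def by (intro Max_in) (auto simp del: atLeastAtMost_iff)
qed

theorem theorem1p2:
  fixes d m j :: nat and b :: vec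
  assumes "d \<ge> 2" and "m \<ge> 2"
    and "j \<ge> (d + m - 1) choose (m - 1)"
    and "b \<in> NA d m" and "total m b = int (d * j)"
    and "lookup b 0 \<le> ltilde d m j"
  shows "\<forall>p::int. betti TYPE('k::field) d m p b = 0"
proof -
  let ?n = "nvars d m" and ?l = "ltilde d m j"
  have l: "?l \<le> Asum d m j - 1" "phi d m j ?l \<ge> 0"
    using ltilde_in[of d m j] assms by auto
  have "Asum d m j \<le> (\<Sum>i = 1..?n. acoord d m 0 i)"
    unfolding Asum_def by (intro sum_mono2) (auto intro: acoord_nonneg)
  with l(1) have lA: "?l \<le> (\<Sum>i = 1..?n. acoord d m 0 i)" by linarith
  \<comment> \<open>Averaging: the coordinates 1 to \<open>m\<close> of \<open>b\<close> add up to
    \<open>d * j - lookup b 0\<close>, which is at least \<open>d * j - ltilde d m j\<close>, so one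
    of them reaches the mean. The factor \<open>m\<close> postpones the division.\<close>
  have "\<exists>s\<in>{1..m}. int d * int j - ?l \<le> int m * lookup b s"
  proof (rule ccontr)
    assume "\<not> ?thesis"
    then have "int m * lookup b s < int d * int j - ?l" if "s \<in> {1..m}" for s
      using that by (meson not_le)
    then have "(\<Sum>s\<in>{1..m}. int m * lookup b s) < (\<Sum>s\<in>{1..m}. int d * int j - ?l)"
      using assms(2) by (intro sum_strict_mono) auto
    moreover have "{..m} = insert 0 {1..m}" by auto
    then have "(\<Sum>s\<in>{1..m}. lookup b s) = int d * int j - lookup b 0"
      using assms(5) by (simp add: total_def)
    ultimately have "int m * (int d * int j - lookup b 0) < int m * (int d * int j - ?l)"
      by (simp flip: sum_distrib_left)
    with assms(6) show False by (simp add: mult_less_cancel_left)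
  qed
  then obtain s where s: "s \<in> {1..m}" "int d * int j - ?l \<le> int m * lookup b s" by blast
  have "real d * real j - real_of_int ?l \<le> real m * real_of_int (lookup b s)"
    using s(2) by (metis (mono_tags, lifting) of_int_diff of_int_le_iff of_int_mult of_int_of_nat_eq)
  then have "(real d * real j - real_of_int ?l) / real m \<le> real_of_int (lookup b s)"
    using assms(2) by (simp add: field_simps)
  then have "\<lceil>(real d * real j - real_of_int ?l) / real m\<rceil> \<le> lookup b s"
    by (rule ceiling_le)
  with l(2) have fb: "fmax d m ?l \<le> lookup b s" by (simp add: phi_def)
  \<comment> \<open>The apex of the cone is the index of \<open>d\<close> times the unit vector in
    direction \<open>s\<close>: its coordinate 0 is 0, so it consumes nothing of the budget in
    coordinate 0.\<close>
  have "single s (int d) \<in> Avecs d m"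
    using s(1) by (auto simp: Avecs_def zvecs_def total_single lookup_single when_def simp del: single_of_nat)
  then obtain v where v: "v \<in> {1..?n}" "avec d m v = single s (int d)" using avec_surj by blast
  have "b - (\<Sum>i\<in>\<sigma>. avec d m i) - avec d m v \<in> NA d m"
    if \<sigma>: "\<sigma> \<subseteq> {1..?n}" "v \<notin> \<sigma>" and NA: "b - (\<Sum>i\<in>\<sigma>. avec d m i) \<in> NA d m" for \<sigma>
  proof -
    let ?x = "b - (\<Sum>i\<in>\<sigma>. avec d m i)"
    have fin: "finite \<sigma>" using \<sigma>(1) by (rule subset_atLeastAtMost_finite)
    have x: "?x \<in> zvecs m" "\<And>r. 0 \<le> lookup ?x r" "int d dvd total m ?x"
      using NA by (auto simp: NA_iff)
    have lx: "lookup ?x r = lookup b r - (\<Sum>i\<in>\<sigma>. acoord d m r i)" for r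
      by (simp add: lookup_minus lookup_sum)
    \<comment> \<open>The bound by \<open>fmax\<close> is applied to
      \<open>insert v \<sigma>\<close> rather than to \<open>\<sigma>\<close>, which leaves room for
      the whole entry \<open>d\<close> in coordinate \<open>s\<close>.\<close>
    have "(\<Sum>i\<in>insert v \<sigma>. acoord d m 0 i) \<le> ?l"
      using x(2)[of 0] lx[of 0] assms(6) \<sigma>(2) fin s(1) by (simp add: v(2) lookup_single when_def)
    then have "(\<Sum>i\<in>insert v \<sigma>. acoord d m s i) \<le> fmax d m ?l"
      using sum_acoord_le_fmax[OF assms(2) s(1) _ _ lA] \<sigma>(1) v(1) by blast
    then have "int d \<le> lookup ?x s"
      using fb lx[of s] \<sigma>(2) fin by (simp add: v(2))
    then have "0 \<le> lookup (?x - avec d m v) r" for r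
      using x(2)[of r] by (auto simp: lookup_minus v(2) lookup_single when_def)
    moreover have "?x - avec d m v \<in> zvecs m"
      using x(1) avec_in_Avecs[OF v(1)] by (auto simp: Avecs_def intro: zvecs_diff)
    moreover have "int d dvd total m (?x - avec d m v)"
      using x(3) s(1) by (simp add: total_diff[of m ?x] v(2) total_single)
    ultimately show ?thesis by (auto simp: NA_iff)
  qed
  from betti_eq_zero_of_acyclic[OF koszul_acyclic_of_cone[OF v(1) this]]
  show ?thesis by blast
qed

end
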